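(* There is an absolute constant $\alpha_0>0$ such that for every $0<\alpha\le\alpha_0$ and every $C\ge1$ there exist constants $C',c>0$, depending only on $C$ and $\alpha$, such that the following holds for every prime power $q$ and every $n\ge1$. Let $F_1,\dots,F_n\subset[n]=\{1,\dots,n\}$ be index sets such that $|F_i|<\alpha n$ for every $i$, and every index $i\in[n]$ is contained in at most $(1-12\alpha)n$ of the sets $F_j$. Let $X_1,\dots,X_n$ be independent random vectors in $\mathbf{F}_q^n$, where $X_i$ is a near uniform vector of type $F_i$, and let $M_n$ be the $n\times n$ matrix with columns $X_1,\dots,X_n$. Then $$\|Q(M_n)-Q_\infty\|_{TV}\le\Big(\frac{C'}{q}\Big)^{cn}.$$
   Context: A random variable $\xi\in\mathbf{F}_q$ is near uniform with constant $C\ge 1$ if $\mathbf{P}(\xi=k)\le C/q$ for all $k\in\mathbf{F}_q$. A random vector $X\in\mathbf{F}_q^n$ is a near uniform vector of type $F\subset[n]$ if its entries are independent and near uniform (with constant $C$), except that the entries with indices in $F$ may have arbitrary distributions (possibly deterministic), still independent of the other entries. For an $n\times n$ matrix $M$, $Q(M)=n-\operatorname{rank}(M)$ is the corank. $Q_\infty$ is the random variable on $\{0,1,2,\dots\}$ with $$\mathbf{P}(Q_\infty=k)=\frac{1}{q^{k^2}}\frac{\prod_{i=k+1}^\infty(1-1/q^i)}{\prod_{i=1}^k(1-1/q^i)}.$$ $\|\cdot-\cdot\|_{TV}$ is the total variation distance between distributions. *)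

theory Defs
  imports "HOL-Probability.Probability" "Jordan_Normal_Form.Missing_VectorSpace"
begin

text \<open>
  A matrix is the function sending a column index \<open>j \<in> {1..n}\<close> to the \<open>j\<close>-th column, and a column
  is an element of the coordinate space \<open>ring.func_space K {1..n}\<close>, whose carrier
  \<open>{1..n} \<rightarrow>\<^sub>E carrier K\<close> consists of functions that are \<open>undefined\<close> off \<open>{1..n}\<close>. Random objects
  are given by their laws. The finite field is an explicit carrier, rather than a type, so that
  constants can be quantified before the field.
\<close>

definition matrix_rank :: "('a, 'b) ring_scheme \<Rightarrow> nat \<Rightarrow> (nat \<Rightarrow> nat \<Rightarrow> 'a) \<Rightarrow> nat" where
  "matrix_rank K n M =
     (let V = ring.func_space K {1..n}
      in vectorspace.dim K (V\<lparr>carrier := LinearCombinations.module.span K V (M ` {1..n})\<rparr>))"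

definition corank :: "('a, 'b) ring_scheme \<Rightarrow> nat \<Rightarrow> (nat \<Rightarrow> nat \<Rightarrow> 'a) \<Rightarrow> nat" where
  "corank K n M = n - matrix_rank K n M"

definition near_uniform :: "('a, 'b) ring_scheme \<Rightarrow> real \<Rightarrow> 'a pmf \<Rightarrow> bool" where
  "near_uniform K C p \<longleftrightarrow>
     set_pmf p \<subseteq> carrier K \<and> (\<forall>k \<in> carrier K. pmf p k \<le> C / real (card (carrier K)))"

text \<open>
  The entries with index in \<open>F\<close> form a block with an arbitrary joint law that is independent of the
  block of the remaining entries; independence among the entries in \<open>F\<close> is not required.
\<close>

definition near_uniform_vector ::
    "('a, 'b) ring_scheme \<Rightarrow> real \<Rightarrow> nat \<Rightarrow> nat set \<Rightarrow> (nat \<Rightarrow> 'a) pmf \<Rightarrow> bool" where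
  "near_uniform_vector K C n F \<mu> \<longleftrightarrow>
     set_pmf \<mu> \<subseteq> {1..n} \<rightarrow>\<^sub>E carrier K \<and>
     (\<forall>i \<in> {1..n} - F. near_uniform K C (map_pmf (\<lambda>x. x i) \<mu>)) \<and>
     prob_space.indep_vars (measure_pmf \<mu>) (\<lambda>_. count_space UNIV) (\<lambda>i x. x i) ({1..n} - F) \<and>
     prob_space.indep_var (measure_pmf \<mu>)
       (count_space UNIV) (\<lambda>x. restrict x F)
       (count_space UNIV) (\<lambda>x. restrict x ({1..n} - F))"

definition Q_infinity_mass :: "nat \<Rightarrow> nat \<Rightarrow> real" where
  "Q_infinity_mass q k =
     1 / real q ^ (k\<^sup>2) * ((\<Prod>i. 1 - 1 / real q ^ (k + 1 + i)) / (\<Prod>i = 1..k. 1 - 1 / real q ^ i))"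

definition Q_infinity :: "nat \<Rightarrow> nat measure" where
  "Q_infinity q = density (count_space UNIV) (\<lambda>k. ennreal (Q_infinity_mass q k))"

definition tv_dist :: "'a measure \<Rightarrow> 'a measure \<Rightarrow> real" where
  "tv_dist M N = (SUP A \<in> sets M. \<bar>measure M A - measure N A\<bar>)"

end

theory Submission
  imports Defs
begin

text \<open>
  Why the corank of \<open>M\<close> is close to \<open>Q\<^sub>\<infinity>\<close>. Reveal the columns one at a time and let \<open>U\<close> be the left
  kernel of the columns seen so far, the set of vectors orthogonal to all of them. If \<open>|U| = q\<^sup>d\<close>, the
  next column \<open>X\<close> either lies in \<open>U\<^sup>\<bottom>\<close>, and then \<open>U\<close> is unchanged, or it cuts \<open>|U|\<close> down by the factor
  \<open>q\<close>. For a uniform column the first case has probability exactly \<open>q\<^sup>-\<^sup>d\<close>, so \<open>d\<close> is a Markov chain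
  (\<open>corank_chain\<close>), and after \<open>l\<close> steps from \<open>d = l\<close> it has the law of the corank of a uniform
  \<open>l \<times> l\<close> matrix. That law has a closed formula (\<open>pmf_corank_chain\<close>), converges to \<open>Q\<^sub>\<infinity>\<close>, and is
  within \<open>2 q\<^sup>-\<^sup>l\<^sup>-\<^sup>1\<close> of its limit, because the chains of lengths \<open>l\<close> and \<open>l + 1\<close> differ only if the very
  first column is zero (\<open>corank_chain_vs_Q_infinity\<close>).

  For the columns of the theorem, averaging \<open>P(u \<cdot> X = 0)\<close> over \<open>u \<in> U\<close> gives
  \<open>1/q + (1 - 1/q) P(X \<in> U\<^sup>\<bottom>)\<close>. So \<open>P(X \<in> U\<^sup>\<bottom>)\<close> is within \<open>2\<epsilon>\<close> of \<open>q\<^sup>-\<^sup>d\<close>, whatever \<open>d\<close> is, as soon as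
  no nonzero \<open>u \<in> U\<close> is biased, meaning that \<open>P(u \<cdot> X = 0)\<close> differs from \<open>1/q\<close> by more than \<open>\<epsilon>\<close>
  (\<open>prob_orthogonal_to_subspace\<close>). The left kernel only shrinks, so this needs to be checked only once,
  after the first \<open>k = n - L\<close> columns with \<open>L\<close> about \<open>2\<alpha>n\<close>; the last \<open>L\<close> steps then follow the chain up
  to the error \<open>2L\<epsilon>\<close> (\<open>left_kernel_follows_chain\<close>). Three exponentially unlikely events spoil this.

  \<^item> The first \<open>k\<close> columns are linearly dependent. A given relation expresses one of its columns
    through the others, so it holds with probability at most \<open>(C/q)\<^bsup>(1-\<alpha>)n\<^esup>\<close>, and \<open>L \<ge> 2\<alpha>n\<close> leaves few
    enough relations (\<open>prob_columns_dependent_le\<close>).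
  \<^item> \<open>U\<close> contains a nonzero vector with fewer than \<open>\<alpha>n\<close> nonzero entries. The row hypothesis provides
    \<open>12\<alpha>n - L\<close> of the first \<open>k\<close> columns each of which is orthogonal to it with probability at most \<open>C/q\<close>
    (\<open>small_support_sum_le\<close>).
  \<^item> \<open>U\<close> contains a biased vector with at least \<open>\<alpha>n\<close> nonzero entries. Biased vectors are rare: the
    second moment of the bias over all \<open>v \<in> K\<^sup>n\<close> only sees pairs of linearly dependent columns
    (\<open>second_moment_bias\<close>), because \<open>v \<cdot> x\<close> and \<open>v \<cdot> y\<close> are independent for uniform \<open>v\<close> if \<open>x\<close> and \<open>y\<close>
    are independent. A union bound over the rare biased vectors suffices (\<open>biased_sum_le\<close>).

  With \<open>\<epsilon> = q\<^bsup>-n/4\<^esup>\<close> every error is at most a constant to the power \<open>n\<close> times \<open>q\<^bsup>-\<alpha>n\<^esup>\<close>. If \<open>\<alpha>n < 1\<close> all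
  the \<open>F\<^sub>i\<close> are empty, and it is enough that \<open>M\<close> is singular with probability \<open>O(1/q)\<close>. If \<open>q\<close> is smaller
  than the constant \<open>C'\<close>, the claimed bound is at least \<open>1\<close>.
\<close>

section \<open>Coordinate spaces over a finite field\<close>

locale finite_field = field K for K :: "('a, 'b) ring_scheme" (structure) +
  assumes finite_field_carrier [simp, intro]: "finite (carrier K)"
begin

abbreviation q :: nat where "q \<equiv> card (carrier K)"

abbreviation vecs :: "'i set \<Rightarrow> ('i \<Rightarrow> 'a) set" where "vecs I \<equiv> I \<rightarrow>\<^sub>E carrier K"

definition dot :: "'i set \<Rightarrow> ('i \<Rightarrow> 'a) \<Rightarrow> ('i \<Rightarrow> 'a) \<Rightarrow> 'a" where
  "dot I u x = (\<Oplus>i\<in>I. u i \<otimes> x i)"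

text \<open>
  The vector \<open>u + c w\<close>, under its usual name in numerical linear algebra. One operation for sums and
  multiples makes linearity a single equation.
\<close>

definition axpy :: "'i set \<Rightarrow> ('i \<Rightarrow> 'a) \<Rightarrow> 'a \<Rightarrow> ('i \<Rightarrow> 'a) \<Rightarrow> 'i \<Rightarrow> 'a" where
  "axpy I u c w = (\<lambda>i\<in>I. u i \<oplus> c \<otimes> w i)"

definition unit_vec :: "'i set \<Rightarrow> 'i \<Rightarrow> 'i \<Rightarrow> 'a" where
  "unit_vec I k = (\<lambda>i\<in>I. if i = k then \<one> else \<zero>)"

definition zero_vec :: "'i set \<Rightarrow> 'i \<Rightarrow> 'a" where
  "zero_vec I = (\<lambda>i\<in>I. \<zero>)"

definition lin_closed :: "'i set \<Rightarrow> ('i \<Rightarrow> 'a) set \<Rightarrow> bool" where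
  "lin_closed I U \<longleftrightarrow> U \<subseteq> vecs I \<and> zero_vec I \<in> U \<and>
     (\<forall>u\<in>U. \<forall>w\<in>U. \<forall>c\<in>carrier K. axpy I u c w \<in> U)"

text \<open>
  For \<open>U = K\<^sup>I\<close> this is the left kernel of the matrix with columns \<open>M j\<close>, \<open>j \<in> J\<close>. A general \<open>U\<close> makes it
  possible to continue from the left kernel of some earlier columns.
\<close>

definition annihilated :: "'i set \<Rightarrow> ('i \<Rightarrow> 'a) set \<Rightarrow> 'j set \<Rightarrow> ('j \<Rightarrow> 'i \<Rightarrow> 'a) \<Rightarrow> ('i \<Rightarrow> 'a) set" where
  "annihilated I U J M = {u \<in> U. \<forall>j\<in>J. dot I u (M j) = \<zero>}"

lemma q_ge_2: "q \<ge> 2"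
proof -
  have "card {\<zero>, \<one>} \<le> q" by (intro card_mono) auto
  thus ?thesis by simp
qed

lemma vecs_in: "u \<in> vecs I \<Longrightarrow> i \<in> I \<Longrightarrow> u i \<in> carrier K" by auto

lemma finite_vec [simp]: "finite I \<Longrightarrow> finite (vecs I)" by (intro finite_PiE) auto

lemma card_vec: "finite I \<Longrightarrow> card (vecs I) = q ^ card I" by (simp add: card_PiE)

lemma vec_eqI: "u \<in> vecs I \<Longrightarrow> w \<in> vecs I \<Longrightarrow> (\<And>i. i \<in> I \<Longrightarrow> u i = w i) \<Longrightarrow> u = w"
  by (rule PiE_ext)

lemma dot_closed [simp]: "u \<in> vecs I \<Longrightarrow> x \<in> vecs I \<Longrightarrow> dot I u x \<in> carrier K"
  unfolding dot_def by (intro finsum_closed) (auto dest: vecs_in)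

lemma dot_commute:
  assumes "u \<in> vecs I" "x \<in> vecs I"
  shows "dot I u x = dot I x u"
proof -
  note [simp] = assms [THEN vecs_in]
  show ?thesis unfolding dot_def by (intro finsum_cong') (auto simp: m_comm)
qed

lemma axpy_in_vec [simp]: "u \<in> vecs I \<Longrightarrow> w \<in> vecs I \<Longrightarrow> c \<in> carrier K \<Longrightarrow> axpy I u c w \<in> vecs I"
  by (auto simp: axpy_def)

lemma zero_vec_in_vec [simp]: "zero_vec I \<in> vecs I" by (auto simp: zero_vec_def)

lemma unit_vec_in_vec [simp]: "unit_vec I k \<in> vecs I" by (auto simp: unit_vec_def)

lemma lin_closed_vec [simp]: "lin_closed I (vecs I)" by (simp add: lin_closed_def)

lemma dot_axpy_left:
  assumes "finite I" "u \<in> vecs I" "w \<in> vecs I" "x \<in> vecs I" "c \<in> carrier K"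
  shows "dot I (axpy I u c w) x = dot I u x \<oplus> c \<otimes> dot I w x"
proof -
  note [simp] = assms(2-4) [THEN vecs_in]
  have "dot I (axpy I u c w) x = (\<Oplus>i\<in>I. u i \<otimes> x i \<oplus> c \<otimes> (w i \<otimes> x i))"
    unfolding dot_def axpy_def using assms 
    by (intro finsum_cong') (auto simp: l_distr m_assoc)
  also have "\<dots> = dot I u x \<oplus> (\<Oplus>i\<in>I. c \<otimes> (w i \<otimes> x i))"
    unfolding dot_def using assms by (intro finsum_addf) auto
  also have "(\<Oplus>i\<in>I. c \<otimes> (w i \<otimes> x i)) = c \<otimes> dot I w x"
    unfolding dot_def using assms by (intro finsum_rdistr [symmetric]) auto
  finally show ?thesis .
qed

lemma dot_zero_vec_left [simp]: "x \<in> vecs I \<Longrightarrow> dot I (zero_vec I) x = \<zero>"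
proof -
  assume "x \<in> vecs I"
  note [simp] = this [THEN vecs_in]
  have "dot I (zero_vec I) x = (\<Oplus>i\<in>I. \<zero>)"
    unfolding dot_def zero_vec_def by (intro finsum_cong') auto
  thus ?thesis by simp
qed

lemma dot_zero_vec_right [simp]: "x \<in> vecs I \<Longrightarrow> dot I x (zero_vec I) = \<zero>"
  by (subst dot_commute) auto

lemma dot_unit_vec_left:
  assumes "finite I" "k \<in> I" "x \<in> vecs I"
  shows "dot I (unit_vec I k) x = x k"
proof -
  note [simp] = assms(3) [THEN vecs_in]
  have "dot I (unit_vec I k) x = (\<Oplus>i\<in>I. if k = i then x i else \<zero>)"
    unfolding dot_def unit_vec_def using assms by (intro finsum_cong') auto
  also have "\<dots> = x k" using assms by (intro finsum_singleton) auto
  finally show ?thesis .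
qed

lemma lin_closed_annihilated:
  assumes "finite I" "lin_closed I U" "\<And>j. j \<in> J \<Longrightarrow> M j \<in> vecs I"
  shows "lin_closed I (annihilated I U J M)"
  using assms unfolding lin_closed_def annihilated_def
  by (auto simp: dot_axpy_left subset_iff)

text \<open>
  The functional \<open>u \<mapsto> u \<cdot> x\<close> takes every value on the line spanned by \<open>w\<close>, so its \<open>q\<close> fibres on \<open>U\<close> are
  translates of each other.
\<close>

lemma card_hyperplane:
  assumes I: "finite I" and U: "lin_closed I U" and x: "x \<in> vecs I"
    and w: "w \<in> U" "dot I w x \<noteq> \<zero>"
  shows "card U = q * card {u \<in> U. dot I u x = \<zero>}"
proof -
  \<comment> \<open>Adding \<open>c a w\<close> to a vector raises its product with \<open>x\<close> by \<open>c\<close>.\<close>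
  define a where "a = inv (dot I w x)"
  have sub: "U \<subseteq> vecs I" and ax: "\<And>u c. u \<in> U \<Longrightarrow> c \<in> carrier K \<Longrightarrow> axpy I u c w \<in> U"
    using U w by (auto simp: lin_closed_def)
  have wv: "w \<in> vecs I" using sub w by auto
  have d: "dot I w x \<in> Units K" using w wv x by (simp add: field_Units)
  have a: "a \<in> carrier K" "a \<otimes> dot I w x = \<one>" using d by (auto simp: a_def)
  have finU: "finite U" using sub I finite_subset finite_vec by blast
  define H where "H c = {u \<in> U. dot I u x = c}" for c
  have dax: "dot I (axpy I u (c \<otimes> a) w) x = dot I u x \<oplus> c" if "u \<in> U" "c \<in> carrier K" for u c
    using that a sub wv x I w by (auto simp: dot_axpy_left m_assoc)
  have cancel: "axpy I (axpy I u c w) (\<ominus> c) w = u" "axpy I (axpy I u (\<ominus> c) w) c w = u"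
    if "u \<in> U" "c \<in> carrier K" for u c
  proof -
    have u: "u \<in> vecs I" using that sub by auto
    note [simp] = u [THEN vecs_in] wv [THEN vecs_in]
    show "axpy I (axpy I u c w) (\<ominus> c) w = u"
      using u that wv by (intro vec_eqI [of _ I]) (auto simp: axpy_def a_assoc l_minus r_neg)
    show "axpy I (axpy I u (\<ominus> c) w) c w = u"
      using u that wv by (intro vec_eqI [of _ I]) (auto simp: axpy_def a_assoc l_minus l_neg)
  qed
  have fibre: "card (H c) = card (H \<zero>)" if c: "c \<in> carrier K" for c
  proof -
    have ca: "c \<otimes> a \<in> carrier K" using a c by simp
    have eq: "\<ominus> (c \<otimes> a) = (\<ominus> c) \<otimes> a" using a c by (simp add: l_minus)
    have "bij_betw (\<lambda>u. axpy I u (c \<otimes> a) w) (H \<zero>) (H c)"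
    proof (rule bij_betw_byWitness [where f' = "\<lambda>u. axpy I u (\<ominus> (c \<otimes> a)) w"])
      show "\<forall>u\<in>H \<zero>. axpy I (axpy I u (c \<otimes> a) w) (\<ominus> (c \<otimes> a)) w = u"
        using cancel(1) ca by (auto simp: H_def)
      show "\<forall>u\<in>H c. axpy I (axpy I u (\<ominus> (c \<otimes> a)) w) (c \<otimes> a) w = u"
        using cancel(2) ca by (auto simp: H_def)
      show "(\<lambda>u. axpy I u (c \<otimes> a) w) ` H \<zero> \<subseteq> H c"
        using ax ca dax c by (auto simp: H_def)
      show "(\<lambda>u. axpy I u (\<ominus> (c \<otimes> a)) w) ` H c \<subseteq> H \<zero>"
        unfolding eq using ax a c dax by (auto simp: H_def r_neg)
    qed
    thus ?thesis by (simp add: bij_betw_same_card)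
  qed
  have "U = (\<Union>c\<in>carrier K. H c)"
    using sub x by (auto simp: H_def)
  also have "card \<dots> = (\<Sum>c\<in>carrier K. card (H c))"
    by (intro card_UN_disjoint) (use finU in \<open>auto simp: H_def\<close>)
  also have "\<dots> = (\<Sum>c\<in>carrier K. card (H \<zero>))" by (intro sum.cong fibre refl)
  also have "\<dots> = q * card (H \<zero>)" by simp
  finally show ?thesis by (simp add: H_def)
qed

lemma card_dot_eq_0:
  assumes I: "finite I" and x: "x \<in> vecs I" "x \<noteq> zero_vec I"
  shows "q * card {u \<in> vecs I. dot I u x = \<zero>} = q ^ card I"
proof -
  note [simp] = x(1) [THEN vecs_in]
  obtain k where k: "k \<in> I" "x k \<noteq> \<zero>"
    using x vec_eqI [OF x(1) zero_vec_in_vec] by (auto simp: zero_vec_def)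
  show ?thesis
    using card_hyperplane [OF I lin_closed_vec x(1), of "unit_vec I k"] k x I
    by (simp add: dot_unit_vec_left card_vec)
qed

text \<open>
  If \<open>x\<^sub>k \<noteq> 0\<close>, then \<open>e\<^sub>i - (x\<^sub>i / x\<^sub>k) e\<^sub>k\<close> is orthogonal to \<open>x\<close>. Testing \<open>y\<close> against it gives
  \<open>y\<^sub>i = (y\<^sub>k / x\<^sub>k) x\<^sub>i\<close>.
\<close>

lemma annihilator_of_annihilator:
  assumes I: "finite I" and x: "x \<in> vecs I" "x \<noteq> zero_vec I" and y: "y \<in> vecs I"
    and sub: "\<And>v. v \<in> vecs I \<Longrightarrow> dot I v x = \<zero> \<Longrightarrow> dot I v y = \<zero>"
  shows "\<exists>c\<in>carrier K. y = (\<lambda>i\<in>I. c \<otimes> x i)"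
proof -
  note [simp] = x(1) [THEN vecs_in]
  obtain k where k: "k \<in> I" "x k \<noteq> \<zero>"
    using x vec_eqI [OF x(1) zero_vec_in_vec] by (auto simp: zero_vec_def)
  note [simp] = y [THEN vecs_in]
  have xk: "x k \<in> Units K" using k x by (simp add: field_Units)
  define a where "a = inv (x k)"
  have a: "a \<in> carrier K" "a \<otimes> x k = \<one>" "x k \<otimes> a = \<one>" using xk by (auto simp: a_def)
  define c where "c = a \<otimes> y k"
  have c: "c \<in> carrier K" using a k y by (auto simp: c_def)
  have "y i = c \<otimes> x i" if i: "i \<in> I" for i
  proof -
    define b where "b = \<ominus> (x i \<otimes> a)"
    have b: "b \<in> carrier K" using x i a by (auto simp: b_def)
    let ?v = "axpy I (unit_vec I i) b (unit_vec I k)"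
    have "dot I ?v x = x i \<oplus> b \<otimes> x k"
      using I b x i k by (simp add: dot_axpy_left dot_unit_vec_left)
    also have "\<dots> = \<zero>" using a x i k by (simp add: b_def l_minus m_assoc r_neg)
    finally have "dot I ?v y = \<zero>" by (intro sub) (use b in auto)
    moreover have "dot I ?v y = y i \<oplus> b \<otimes> y k"
      using I b y i k by (simp add: dot_axpy_left dot_unit_vec_left)
    ultimately have "y i = \<ominus> (b \<otimes> y k)"
      using b y i k by (simp add: minus_equality minus_unique)
    also have "\<dots> = x i \<otimes> a \<otimes> y k"
      using x y i k a by (simp add: b_def l_minus)
    also have "\<dots> = c \<otimes> x i" using x y i k a by (simp add: c_def m_ac)
    finally show ?thesis .
  qed
  thus ?thesis using c y x by (intro bexI [of _ c] vec_eqI [of _ I]) auto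
qed

text \<open>
  By the previous lemma \<open>y\<close> does not vanish identically on the hyperplane orthogonal to \<open>x\<close>, so it cuts that
  hyperplane down by one more factor \<open>q\<close>.
\<close>

lemma card_two_annihilated:
  assumes I: "finite I" and x: "x \<in> vecs I" "x \<noteq> zero_vec I" and y: "y \<in> vecs I"
    and indep: "\<And>c. c \<in> carrier K \<Longrightarrow> y \<noteq> (\<lambda>i\<in>I. c \<otimes> x i)"
  shows "q\<^sup>2 * card {v \<in> vecs I. dot I v x = \<zero> \<and> dot I v y = \<zero>} = q ^ card I"
proof -
  let ?U = "{v \<in> vecs I. dot I v x = \<zero>}"
  have "lin_closed I ?U"
    using lin_closed_annihilated [OF I lin_closed_vec, of "{()}" "\<lambda>_. x"] x
    by (simp add: annihilated_def)
  moreover obtain w where "w \<in> ?U" "dot I w y \<noteq> \<zero>"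
    using annihilator_of_annihilator [OF I x y] indep by blast
  ultimately have "card ?U = q * card {v \<in> ?U. dot I v y = \<zero>}"
    using I y by (intro card_hyperplane)
  moreover have "{v \<in> ?U. dot I v y = \<zero>} = {v \<in> vecs I. dot I v x = \<zero> \<and> dot I v y = \<zero>}" by auto
  ultimately have "q * card {v \<in> vecs I. dot I v x = \<zero> \<and> dot I v y = \<zero>} = card ?U" by (simp only:)
  thus ?thesis
    using card_dot_eq_0 [OF I x] unfolding power2_eq_square mult.assoc by (simp only:)
qed

lemma dot_dot_swap:
  assumes I: "finite I" and J: "finite J" and u: "u \<in> vecs I" and a: "a \<in> vecs J"
    and M: "\<And>j. j \<in> J \<Longrightarrow> M j \<in> vecs I"
  shows "dot J a (\<lambda>j\<in>J. dot I u (M j)) = dot I u (\<lambda>i\<in>I. dot J a (\<lambda>j\<in>J. M j i))"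
proof -
  have c: "u i \<in> carrier K" "a j \<in> carrier K" "M j i \<in> carrier K" if "i \<in> I" "j \<in> J" for i j
    using that u a M by auto
  have "a j \<otimes> dot I u (M j) = (\<Oplus>i\<in>I. a j \<otimes> (u i \<otimes> M j i))" if "j \<in> J" for j
    unfolding dot_def using that c a I by (intro finsum_rdistr) auto
  hence "dot J a (\<lambda>j\<in>J. dot I u (M j)) = (\<Oplus>j\<in>J. \<Oplus>i\<in>I. a j \<otimes> (u i \<otimes> M j i))"
    unfolding dot_def [of J] by (intro finsum_cong') (simp_all add: c Pi_def finsum_closed)
  also have "\<dots> = (\<Oplus>i\<in>I. \<Oplus>j\<in>J. a j \<otimes> (u i \<otimes> M j i))"
    using c I J by (intro finsum_finsum_swap) simp_all
  also have "\<dots> = dot I u (\<lambda>i\<in>I. dot J a (\<lambda>j\<in>J. M j i))"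
  proof -
    have "u i \<otimes> dot J a (\<lambda>j\<in>J. M j i) = (\<Oplus>j\<in>J. a j \<otimes> (u i \<otimes> M j i))" if i: "i \<in> I" for i
    proof -
      have "u i \<otimes> dot J a (\<lambda>j\<in>J. M j i) = (\<Oplus>j\<in>J. u i \<otimes> (a j \<otimes> (\<lambda>j\<in>J. M j i) j))"
        unfolding dot_def using i c u J by (intro finsum_rdistr) auto
      also have "\<dots> = (\<Oplus>j\<in>J. a j \<otimes> (u i \<otimes> M j i))"
        using i c by (intro finsum_cong') (simp_all add: m_lcomm Pi_def)
      finally show ?thesis .
    qed
    thus ?thesis
      unfolding dot_def [of I] by (intro finsum_cong') (simp_all add: c Pi_def finsum_closed dot_def)
  qed
  finally show ?thesis .
qed

text \<open>
  The pairs \<open>(u, a)\<close> with \<open>u M a = 0\<close> are counted row by row: a \<open>u\<close> in the left kernel accepts every \<open>a\<close>, and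
  any other \<open>u\<close> accepts a fraction \<open>1/q\<close> of them.
\<close>

lemma card_annihilating_pairs:
  assumes I: "finite I" and J: "finite J" and M: "\<And>j. j \<in> J \<Longrightarrow> M j \<in> vecs I"
  shows "real q * card {(u, a) \<in> vecs I \<times> vecs J. dot J a (\<lambda>j\<in>J. dot I u (M j)) = \<zero>} =
    real q ^ card J * (real q ^ card I + (real q - 1) * card (annihilated I (vecs I) J M))"
proof -
  let ?S = "{(u, a) \<in> vecs I \<times> vecs J. dot J a (\<lambda>j\<in>J. dot I u (M j)) = \<zero>}"
  let ?L = "annihilated I (vecs I) J M"
  let ?y = "\<lambda>u. \<lambda>j\<in>J. dot I u (M j)"
  have y: "?y u \<in> vecs J" if "u \<in> vecs I" for u using that M by auto
  have Lsub: "?L \<subseteq> vecs I" by (auto simp: annihilated_def)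
  have row: "real q * card {a \<in> vecs J. dot J a (?y u) = \<zero>} =
      (if u \<in> ?L then real q * real q ^ card J else real q ^ card J)" if u: "u \<in> vecs I" for u
  proof (cases "u \<in> ?L")
    case True
    hence "?y u = zero_vec J" by (auto simp: annihilated_def zero_vec_def)
    hence "{a \<in> vecs J. dot J a (?y u) = \<zero>} = vecs J"
      by (auto simp: dot_zero_vec_right)
    thus ?thesis using True J by (simp add: card_vec)
  next
    case False
    hence "?y u \<noteq> zero_vec J"
      using u by (auto simp: annihilated_def zero_vec_def fun_eq_iff restrict_def split: if_splits)
    from card_dot_eq_0 [OF J y [OF u] this] have "real (q * card {a \<in> vecs J. dot J a (?y u) = \<zero>}) = real (q ^ card J)" by (simp only:)
    thus ?thesis using False by simp
  qed
  have "?S = (SIGMA u:vecs I. {a \<in> vecs J. dot J a (?y u) = \<zero>})" by blast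
  hence "card ?S = (\<Sum>u\<in>vecs I. card {a \<in> vecs J. dot J a (?y u) = \<zero>})"
    using card_SigmaI [of "vecs I" "\<lambda>u. {a \<in> vecs J. dot J a (?y u) = \<zero>}"]
      finite_vec [OF I] finite_vec [OF J] by auto
  hence "real q * card ?S = (\<Sum>u\<in>vecs I. real q * card {a \<in> vecs J. dot J a (?y u) = \<zero>})"
    by (simp only: of_nat_sum sum_distrib_left)
  also have "\<dots> = (\<Sum>u\<in>vecs I. if u \<in> ?L then real q * real q ^ card J else real q ^ card J)"
    by (intro sum.cong row refl)
  also have "\<dots> = (\<Sum>u\<in>vecs I. real q ^ card J + (if u \<in> ?L then (real q - 1) * real q ^ card J else 0))"
    by (intro sum.cong refl) (simp add: left_diff_distrib)
  also have "\<dots> = real (card (vecs I)) * real q ^ card J + (\<Sum>u\<in>vecs I. if u \<in> ?L then (real q - 1) * real q ^ card J else 0)"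
    by (simp only: sum.distrib sum_constant)
  also have "(\<Sum>u\<in>vecs I. if u \<in> ?L then (real q - 1) * real q ^ card J else 0) =
      (\<Sum>u\<in>vecs I \<inter> ?L. (real q - 1) * real q ^ card J)"
    using finite_vec [OF I] by (rule sum.inter_restrict [symmetric])
  also have "vecs I \<inter> ?L = ?L" using Lsub by (rule Int_absorb1)
  finally show ?thesis unfolding card_vec [OF I] sum_constant of_nat_power
    by (simp only: distrib_left mult_ac)
qed

text \<open>
  Row rank equals column rank, in the form in which it is used later: the count of the previous lemma is
  the same for \<open>M\<close> and for its transpose.
\<close>

lemma card_left_right_kernel:
  assumes I: "finite I" and J: "finite J" and M: "\<And>j. j \<in> J \<Longrightarrow> M j \<in> vecs I"
  shows "q ^ card J * card (annihilated I (vecs I) J M) =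
         q ^ card I * card (annihilated J (vecs J) I (\<lambda>i. \<lambda>j\<in>J. M j i))"
proof -
  let ?T = "\<lambda>i. \<lambda>j\<in>J. M j i"
  let ?L = "annihilated I (vecs I) J M" and ?R = "annihilated J (vecs J) I ?T"
  let ?S = "{(u, a) \<in> vecs I \<times> vecs J. dot J a (\<lambda>j\<in>J. dot I u (M j)) = \<zero>}"
  let ?S' = "{(a, u) \<in> vecs J \<times> vecs I. dot I u (\<lambda>i\<in>I. dot J a (?T i)) = \<zero>}"
  have "?S' = prod.swap ` ?S"
    using dot_dot_swap [OF I J _ _ M] by (auto simp: image_iff)
  hence eq: "card ?S' = card ?S" by (simp add: card_image)
  have "real q * card ?S = real q ^ card J * (real q ^ card I + (real q - 1) * card ?L)"
    by (rule card_annihilating_pairs [OF I J M])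
  moreover have "real q * card ?S' = real q ^ card I * (real q ^ card J + (real q - 1) * card ?R)"
    by (rule card_annihilating_pairs [OF J I]) (use M in auto)
  ultimately have "real q ^ card J * (real q ^ card I + (real q - 1) * card ?L) =
      real q ^ card I * (real q ^ card J + (real q - 1) * card ?R)"
    unfolding eq by (rule trans [OF sym])
  hence "(real q - 1) * (real q ^ card J * card ?L) = (real q - 1) * (real q ^ card I * card ?R)"
    by argo
  hence "real q ^ card J * card ?L = real q ^ card I * card ?R"
    using q_ge_2 by simp
  hence "real (q ^ card J * card ?L) = real (q ^ card I * card ?R)" by simp
  thus ?thesis by (simp only: of_nat_eq_iff)
qed

end

section \<open>Corank and the left kernel\<close>

text \<open>
  Coordinates with respect to a basis are a bijection onto the functions from the basis to the scalars.
\<close>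

lemma (in vectorspace) card_carrier_eq_power_dim:
  assumes fin: "finite (carrier V)"
  shows "fin_dim" and "card (carrier V) = card (carrier K) ^ dim"
proof -
  have "span (carrier V) = carrier V"
    using in_own_span [of "carrier V"] span_is_subset2 [of "carrier V"] by blast
  thus fd: fin_dim unfolding fin_dim_def using fin by blast
  then obtain B where B: "finite B" "basis B" using finite_basis_exists by blast
  hence BV: "B \<subseteq> carrier V" by (simp add: basis_def)
  have ex1: "\<exists>!a. a \<in> B \<rightarrow>\<^sub>E carrier K \<and> lincomb a B = v" if "v \<in> carrier V" for v
    using basis_criterion [OF B(1) BV] B(2) that by blast
  have cl: "lincomb a B \<in> carrier V" if "a \<in> B \<rightarrow>\<^sub>E carrier K" for a
    using that BV by (intro lincomb_closed) (auto simp: PiE_def)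
  have "bij_betw (\<lambda>a. lincomb a B) (B \<rightarrow>\<^sub>E carrier K) (carrier V)"
    unfolding bij_betw_def inj_on_def using ex1 cl by (auto simp: image_iff) metis+
  hence "card (carrier V) = card (B \<rightarrow>\<^sub>E carrier K)" by (simp add: bij_betw_same_card)
  thus "card (carrier V) = card (carrier K) ^ dim"
    using B by (simp add: card_PiE dim_basis)
qed

context finite_field
begin

lemma linear_map_of_columns:
  assumes I: "finite I" and J: "finite J" and M: "\<And>j. j \<in> J \<Longrightarrow> M j \<in> vecs I"
  shows "linear_map K (func_space J) (func_space I) (\<lambda>a. \<lambda>i\<in>I. dot J a (\<lambda>j\<in>J. M j i))"
proof -
  have row: "(\<lambda>j\<in>J. M j i) \<in> vecs J" if "i \<in> I" for i using that M by auto
  have add: "dot J (\<lambda>j\<in>J. a j \<oplus> b j) x = dot J a x \<oplus> dot J b x"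
    if "a \<in> vecs J" "b \<in> vecs J" "x \<in> vecs J" for a b x
  proof -
    have "(\<lambda>j\<in>J. a j \<oplus> b j) = axpy J a \<one> b"
      using vecs_in [OF that(2)] by (auto simp: axpy_def restrict_def fun_eq_iff)
    thus ?thesis using dot_axpy_left [OF J that one_closed] that by simp
  qed
  have smult: "dot J (\<lambda>j\<in>J. c \<otimes> a j) x = c \<otimes> dot J a x"
    if "a \<in> vecs J" "x \<in> vecs J" "c \<in> carrier K" for a c x
  proof -
    have "(\<lambda>j\<in>J. c \<otimes> a j) = axpy J (zero_vec J) c a"
      using vecs_in [OF that(1)] that(3) by (auto simp: axpy_def zero_vec_def restrict_def fun_eq_iff)
    thus ?thesis using dot_axpy_left [OF J zero_vec_in_vec that(1,2,3)] that by simp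
  qed
  interpret V: module K "func_space J" by (rule func_space_is_module)
  interpret W: module K "func_space I" by (rule func_space_is_module)
  define r where "r i = (\<lambda>j\<in>J. M j i)" for i
  have r: "r i \<in> vecs J" if "i \<in> I" for i using row [OF that] by (simp only: r_def)
  have "(\<lambda>a. \<lambda>i\<in>I. dot J a (r i)) \<in> module_hom K (func_space J) (func_space I)"
    unfolding module_hom_def func_space_def
    by (auto simp: add smult r intro!: restrict_ext dot_closed)
  hence "(\<lambda>a. \<lambda>i\<in>I. dot J a (\<lambda>j\<in>J. M j i)) \<in> module_hom K (func_space J) (func_space I)"
    unfolding r_def .
  thus ?thesis
    by (intro linear_map.intro vectorspace.intro mod_hom.intro mod_hom_axioms.intro
        func_space_is_module field_axioms)
qed

text \<open>
  By the rank-nullity theorem the corank is the dimension of the right kernel, and the right kernel of a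
  square matrix has as many elements as the left kernel. All later arguments about the corank are
  therefore arguments about the size of a left kernel.
\<close>

lemma power_corank_eq_card_left_kernel:
  fixes n :: nat
  defines "I \<equiv> {1..n}"
  assumes M: "\<And>j. j \<in> I \<Longrightarrow> M j \<in> vecs I"
  shows "q ^ corank K n M = card (annihilated I (vecs I) I M)"
proof -
  have I [simp]: "finite I" and cI: "card I = n" by (simp_all add: I_def)
  define T where "T = (\<lambda>a. \<lambda>i\<in>I. dot I a (\<lambda>j\<in>I. M j i))"
  interpret fs: vectorspace K "func_space I"
    by (intro vectorspace.intro func_space_is_module field_axioms)
  interpret T: linear_map K "func_space I" "func_space I" T
    unfolding T_def by (rule linear_map_of_columns) (use M in auto)
  have car: "carrier (func_space I) = vecs I" by (simp add: func_space_def)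
  have fin: "finite (carrier (func_space I))" by (simp add: car)
  have colsub: "M ` I \<subseteq> carrier (func_space I)" using M by (auto simp: car)
  interpret S: submodule K "fs.span (M ` I)" "func_space I"
    using fs.span_is_submodule [OF colsub] .
  \<comment> \<open>Partial sums are treated so that induction on the set of columns applies.\<close>
  have partial: "(\<lambda>i\<in>I. dot J a (\<lambda>j\<in>J. M j i)) \<in> fs.span (M ` I)"
    if a: "a \<in> vecs I" and J: "J \<subseteq> I" for a J
    using finite_subset [OF J I] J
  proof (induction J rule: finite_induct)
    case empty
    have "(\<lambda>i\<in>I. dot {} a (\<lambda>j\<in>{}. M j i)) = \<zero>\<^bsub>func_space I\<^esub>"
      by (simp add: dot_def func_space_def)
    thus ?case using S.zero_closed by (simp only:)
  next
    case (insert k J)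
    have k: "k \<in> I" "a k \<in> carrier K" using insert.prems vecs_in [OF a] by auto
    have c: "a j \<in> carrier K" "M j i \<in> carrier K" if "j \<in> insert k J" "i \<in> I" for i j
      using that insert.prems vecs_in [OF a] vecs_in [OF M] by auto
    have "dot (insert k J) a (\<lambda>j\<in>insert k J. M j i) = a k \<otimes> M k i \<oplus> dot J a (\<lambda>j\<in>J. M j i)"
      if i: "i \<in> I" for i
    proof -
      have "dot (insert k J) a (\<lambda>j\<in>insert k J. M j i) =
          a k \<otimes> M k i \<oplus> (\<Oplus>j\<in>J. a j \<otimes> (\<lambda>j\<in>insert k J. M j i) j)"
        unfolding dot_def using insert.hyps c i by (subst finsum_insert) auto
      also have "(\<Oplus>j\<in>J. a j \<otimes> (\<lambda>j\<in>insert k J. M j i) j) = dot J a (\<lambda>j\<in>J. M j i)"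
        unfolding dot_def using insert.hyps c i by (intro finsum_cong') auto
      finally show ?thesis .
    qed
    hence "(\<lambda>i\<in>I. dot (insert k J) a (\<lambda>j\<in>insert k J. M j i)) =
        (a k \<odot>\<^bsub>func_space I\<^esub> M k) \<oplus>\<^bsub>func_space I\<^esub> (\<lambda>i\<in>I. dot J a (\<lambda>j\<in>J. M j i))"
      by (auto simp: func_space_def intro!: restrict_ext)
    moreover have "M k \<in> fs.span (M ` I)"
      using fs.in_own_span [OF colsub] k by auto
    moreover have "(\<lambda>i\<in>I. dot J a (\<lambda>j\<in>J. M j i)) \<in> fs.span (M ` I)"
      using insert.prems by (intro insert.IH) blast
    ultimately show ?case
      using S.m_closed [OF S.smult_closed [OF k(2)]] by (simp only:)
  qed
  have "T.im = fs.span (M ` I)"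
  proof
    show "T.im \<subseteq> fs.span (M ` I)"
      unfolding T.im_def car using partial [of _ I] by (auto simp: T_def)
    have "M ` I \<subseteq> T.im"
    proof
      fix x assume "x \<in> M ` I"
      then obtain k where k: "k \<in> I" "x = M k" by auto
      have "dot I (unit_vec I k) (\<lambda>j\<in>I. M j i) = M k i" if "i \<in> I" for i
        using dot_unit_vec_left [OF I k(1), of "\<lambda>j\<in>I. M j i"] that k(1) vecs_in [OF M] by auto
      hence "T (unit_vec I k) = M k"
        unfolding T_def by (intro vec_eqI [of _ I]) (use M k vecs_in [OF M [OF k(1)]] in auto)
      thus "x \<in> T.im" unfolding T.im_def car using k by (metis image_eqI unit_vec_in_vec)
    qed
    thus "fs.span (M ` I) \<subseteq> T.im" by (rule fs.span_is_subset [OF _ T.im_is_submodule])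
  qed
  hence rank: "matrix_rank K n M = vectorspace.dim K (func_space I\<lparr>carrier := T.im\<rparr>)"
    unfolding matrix_rank_def Let_def I_def by (simp only:)
  have dimV: "fs.dim = n"
  proof -
    have "q ^ n = q ^ fs.dim"
      using fs.card_carrier_eq_power_dim(2) [OF fin] card_vec [OF I] by (simp add: car cI)
    thus ?thesis using q_ge_2 by (simp add: power_inject_exp)
  qed
  have "T.ker \<subseteq> carrier (func_space I)" by (auto simp: T.ker_def)
  hence fk: "finite T.ker" using fin finite_subset by blast
  interpret k: vectorspace K "func_space I\<lparr>carrier := T.ker\<rparr>"
    by (rule fs.subspace_is_vs [OF T.kerT_is_subspace])
  have "corank K n M = k.dim"
    using T.rank_nullity [OF fs.card_carrier_eq_power_dim(1) [OF fin]] rank dimV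
    by (simp add: corank_def)
  hence "q ^ corank K n M = card T.ker"
    using k.card_carrier_eq_power_dim(2) fk by simp
  also have "T.ker = annihilated I (vecs I) I (\<lambda>i. \<lambda>j\<in>I. M j i)"
  proof -
    have "restrict f I = restrict g I \<longleftrightarrow> (\<forall>i\<in>I. f i = g i)" for f g :: "nat \<Rightarrow> 'a"
      by (metis restrict_apply' restrict_ext)
    moreover have "\<zero>\<^bsub>func_space I\<^esub> = (\<lambda>i\<in>I. \<zero>)" by (simp add: func_space_def)
    ultimately show ?thesis unfolding T.ker_def car annihilated_def by (simp only: T_def)
  qed
  also have "card \<dots> = card (annihilated I (vecs I) I M)"
  proof -
    have "q ^ card I \<noteq> 0" using q_ge_2 by (intro power_not_zero) linarith
    moreover have "q ^ card I * card (annihilated I (vecs I) I M) =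
        q ^ card I * card (annihilated I (vecs I) I (\<lambda>i. \<lambda>j\<in>I. M j i))"
      by (rule card_left_right_kernel [OF I I M])
    ultimately show ?thesis by (metis mult_left_cancel)
  qed
  finally show ?thesis .
qed

end

section \<open>A single near uniform column\<close>

lemma prob_eq_sum_pmf:
  assumes "finite S" "set_pmf p \<subseteq> S"
  shows "measure_pmf.prob p {x. P x} = (\<Sum>x\<in>S. of_bool (P x) * pmf p x)"
proof -
  have "measure_pmf.prob p {x. P x} = measure_pmf.prob p {x \<in> S. P x}"
    by (rule measure_prob_cong_0) (use assms in \<open>auto simp: set_pmf_iff\<close>)
  also have "\<dots> = (\<Sum>x\<in>S. if P x then pmf p x else 0)"
    using assms by (subst measure_measure_pmf_finite) (auto simp: sum.inter_filter [symmetric])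
  also have "\<dots> = (\<Sum>x\<in>S. of_bool (P x) * pmf p x)" by (intro sum.cong) auto
  finally show ?thesis .
qed

context finite_field
begin

lemma carrier_nonempty [simp]: "carrier K \<noteq> {}"
  using zero_closed by blast

lemma near_uniform_vectorD:
  assumes "near_uniform_vector K C n F \<mu>"
  shows "set_pmf \<mu> \<subseteq> vecs {1..n}"
    and "i \<in> {1..n} - F \<Longrightarrow> pmf (map_pmf (\<lambda>x. x i) \<mu>) c \<le> C / q"
    and "i \<in> {1..n} - F \<Longrightarrow> set_pmf (map_pmf (\<lambda>x. x i) \<mu>) \<subseteq> carrier K"
proof -
  show "set_pmf \<mu> \<subseteq> vecs {1..n}" using assms by (simp add: near_uniform_vector_def)
  assume "i \<in> {1..n} - F"
  hence nu: "near_uniform K C (map_pmf (\<lambda>x. x i) \<mu>)"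
    using assms by (simp add: near_uniform_vector_def)
  thus *: "set_pmf (map_pmf (\<lambda>x. x i) \<mu>) \<subseteq> carrier K" by (simp add: near_uniform_def)
  show "pmf (map_pmf (\<lambda>x. x i) \<mu>) c \<le> C / q"
  proof (cases "c \<in> carrier K")
    case True
    thus ?thesis using nu by (simp add: near_uniform_def)
  next
    case False
    hence "pmf (map_pmf (\<lambda>x. x i) \<mu>) c = 0" using * pmf_eq_0_set_pmf by fast
    moreover have "pmf (map_pmf (\<lambda>x. x i) \<mu>) \<zero> \<le> C / q"
      using nu by (simp add: near_uniform_def)
    ultimately show ?thesis using pmf_nonneg order_trans by metis
  qed
qed

lemma prob_free_coordinates:
  assumes nu: "near_uniform_vector K C n F \<mu>" and J: "J \<subseteq> {1..n} - F"
  shows "measure_pmf.prob \<mu> {x. \<forall>i\<in>J. x i = w i} = (\<Prod>i\<in>J. pmf (map_pmf (\<lambda>x. x i) \<mu>) (w i))"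
proof (cases "J = {}")
  case False
  have ind: "prob_space.indep_vars (measure_pmf \<mu>) (\<lambda>_. count_space UNIV) (\<lambda>i x. x i) ({1..n} - F)"
    using nu by (simp add: near_uniform_vector_def)
  have "measure_pmf.prob \<mu> (\<Inter>i\<in>J. (\<lambda>x. x i) -` {w i} \<inter> space \<mu>) =
      (\<Prod>i\<in>J. measure_pmf.prob \<mu> ((\<lambda>x. x i) -` {w i} \<inter> space \<mu>))"
    by (rule prob_space.indep_varsD [OF measure_pmf.prob_space_axioms ind False _ J]) (use J in \<open>auto intro: finite_subset\<close>)
  moreover have "(\<Inter>i\<in>J. (\<lambda>x. x i) -` {w i} \<inter> space \<mu>) = {x. \<forall>i\<in>J. x i = w i}"
    using False by auto
  ultimately show ?thesis by (simp add: pmf_map)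
qed simp

lemma pmf_near_uniform_vector_le:
  assumes nu: "near_uniform_vector K C n F \<mu>"
  shows "pmf \<mu> w \<le> (C / q) ^ card ({1..n} - F)"
proof -
  have "pmf \<mu> w \<le> measure_pmf.prob \<mu> {x. \<forall>i\<in>{1..n} - F. x i = w i}"
    by (subst measure_pmf_single [symmetric]) (auto intro!: measure_pmf.finite_measure_mono)
  also have "\<dots> = (\<Prod>i\<in>{1..n} - F. pmf (map_pmf (\<lambda>x. x i) \<mu>) (w i))"
    by (rule prob_free_coordinates [OF nu order_refl])
  also have "\<dots> \<le> (\<Prod>i\<in>{1..n} - F. C / q)"
    by (intro prod_mono conjI near_uniform_vectorD(2) [OF nu]) auto
  finally show ?thesis by simp
qed

text \<open>
  The independence of the block \<open>F\<close> from the other entries and the mutual independence of those entries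
  combine to a factorisation of the point masses. This is the form in which independence is used below.
\<close>

lemma pmf_near_uniform_vector_factor:
  assumes nu: "near_uniform_vector K C n F \<mu>" and F: "F \<subseteq> {1..n}" and x: "x \<in> vecs {1..n}"
  shows "pmf \<mu> x = pmf (map_pmf (\<lambda>x. restrict x F) \<mu>) (restrict x F) *
    (\<Prod>i\<in>{1..n} - F. pmf (map_pmf (\<lambda>x. x i) \<mu>) (x i))"
proof -
  let ?I = "{1..n}" and ?G = "{1..n} - F"
  have ind: "prob_space.indep_var (measure_pmf \<mu>)
       (count_space UNIV) (\<lambda>x. restrict x F) (count_space UNIV) (\<lambda>x. restrict x ?G)"
    using nu by (simp add: near_uniform_vector_def)
  let ?E = "(\<lambda>y. (restrict y F, restrict y ?G)) -` ({restrict x F} \<times> {restrict x ?G})"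
  have split: "y = x" if "y \<in> vecs ?I" "restrict y F = restrict x F" "restrict y ?G = restrict x ?G" for y
  proof (rule vec_eqI [OF that(1) x])
    fix i assume "i \<in> ?I"
    show "y i = x i"
    proof (cases "i \<in> F")
      case True thus ?thesis using fun_cong [OF that(2), of i] by simp
    next
      case False thus ?thesis using fun_cong [OF that(3), of i] \<open>i \<in> ?I\<close> by simp
    qed
  qed
  have "pmf \<mu> x = measure_pmf.prob \<mu> {x}" by (simp add: measure_pmf_single)
  also have "\<dots> = measure_pmf.prob \<mu> ?E"
  proof (rule measure_prob_cong_0)
    fix y assume "y \<in> ?E - {x}"
    hence "y \<notin> vecs ?I" using split by auto
    thus "pmf \<mu> y = 0" using near_uniform_vectorD(1) [OF nu] by (auto simp: set_pmf_iff)
  qed auto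
  also have "\<dots> = measure_pmf.prob \<mu> ((\<lambda>y. restrict y F) -` {restrict x F}) *
      measure_pmf.prob \<mu> ((\<lambda>y. restrict y ?G) -` {restrict x ?G})"
    using prob_space.indep_varD [OF measure_pmf.prob_space_axioms ind, of "{restrict x F}" "{restrict x ?G}"] by simp
  also have "(\<lambda>y. restrict y ?G) -` {restrict x ?G} = {y. \<forall>i\<in>?G. y i = x i}"
    by (auto simp: restrict_def fun_eq_iff split: if_splits)
  also have "measure_pmf.prob \<mu> \<dots> = (\<Prod>i\<in>?G. pmf (map_pmf (\<lambda>x. x i) \<mu>) (x i))"
    by (rule prob_free_coordinates [OF nu order_refl])
  finally show ?thesis by (simp only: pmf_map)
qed

lemma dot_remove:
  assumes "finite I" "i \<in> I" "v \<in> vecs I" "x \<in> vecs I"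
  shows "dot I v x = v i \<otimes> x i \<oplus> dot (I - {i}) v x"
proof -
  note [simp] = assms(3,4) [THEN vecs_in]
  have "I = insert i (I - {i})" using assms by auto
  hence "dot I v x = dot (insert i (I - {i})) v x" by simp
  also have "\<dots> = v i \<otimes> x i \<oplus> dot (I - {i}) v x"
    unfolding dot_def using assms by (subst finsum_insert) auto
  finally show ?thesis .
qed

text \<open>
  Given all entries of \<open>X\<close> other than the \<open>i\<close>-th, the equation \<open>v \<cdot> X = 0\<close> determines the \<open>i\<close>-th one, and a
  single value of that entry has probability at most \<open>C/q\<close>.
\<close>

lemma prob_dot_eq_0_le:
  assumes nu: "near_uniform_vector K C n F \<mu>" and F: "F \<subseteq> {1..n}"
    and v: "v \<in> vecs {1..n}" and i: "i \<in> {1..n} - F" "v i \<noteq> \<zero>"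
  shows "measure_pmf.prob \<mu> {x. dot {1..n} v x = \<zero>} \<le> C / q"
proof -
  let ?I = "{1..n}"
  define p where "p k = pmf (map_pmf (\<lambda>x. x k) \<mu>)" for k
  \<comment> \<open>The point mass without the factor of the \<open>i\<close>-th entry: the law of all other entries.\<close>
  define r where "r y = pmf (map_pmf (\<lambda>x. restrict x F) \<mu>) (restrict y F) * (\<Prod>k\<in>?I - F - {i}. p k (y k))" for y
  define S where "S = {x \<in> vecs ?I. dot ?I v x = \<zero>}"
  have finS: "finite S" unfolding S_def by simp
  have rpos: "r y \<ge> 0" for y by (auto simp: r_def p_def intro!: mult_nonneg_nonneg prod_nonneg)
  have Cq: "0 \<le> C / q" using near_uniform_vectorD(2) [OF nu i(1)] pmf_nonneg order_trans by metis
  have fac: "pmf \<mu> x = p i (x i) * r x" if "x \<in> vecs ?I" for x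
    using pmf_near_uniform_vector_factor [OF nu F that]
      prod.remove [of "?I - F" i "\<lambda>k. p k (x k)"] i(1)
    by (simp only: r_def p_def finite_Diff finite_atLeastAtMost mult_ac)
  have r_restrict: "r x = r y" if "\<And>k. k \<in> ?I - {i} \<Longrightarrow> x k = y k" for x y
  proof -
    have "restrict x F = restrict y F" using F i that by (intro restrict_ext) blast
    thus ?thesis unfolding r_def using that by (auto intro!: prod.cong)
  qed
  have "(\<Sum>c\<in>carrier K. p i c) = 1"
    unfolding p_def by (intro sum_pmf_eq_1 near_uniform_vectorD(3) [OF nu i(1)]) auto
  hence "(\<Sum>y\<in>vecs (?I - {i}). r y) = (\<Sum>(c, y)\<in>carrier K \<times> vecs (?I - {i}). p i c * r y)"
    by (simp add: sum.cartesian_product [symmetric] sum_product [symmetric])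
  also have "\<dots> = (\<Sum>(c, y)\<in>carrier K \<times> vecs (?I - {i}). pmf \<mu> (y(i := c)))"
  proof (intro sum.cong refl, clarify)
    fix c y assume "c \<in> carrier K" "y \<in> vecs (?I - {i})"
    hence "y(i := c) \<in> vecs ?I" using i by (auto simp: PiE_iff extensional_def)
    moreover have "r (y(i := c)) = r y" by (rule r_restrict) auto
    ultimately show "p i c * r y = pmf \<mu> (y(i := c))" using fac by simp
  qed
  also have "\<dots> = (\<Sum>x\<in>vecs ?I. pmf \<mu> x)"
  proof -
    have "?I = insert i (?I - {i})" using i by auto
    hence "vecs ?I = (\<lambda>(c, y). y(i := c)) ` (carrier K \<times> vecs (?I - {i}))"
      using PiE_insert_eq [of i "?I - {i}" "\<lambda>_. carrier K"] by simp
    moreover have "inj_on (\<lambda>(c, y). y(i := c)) (carrier K \<times> vecs (?I - {i}))"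
      by (rule inj_combinator) auto
    ultimately show ?thesis by (simp add: sum.reindex case_prod_unfold)
  qed
  also have "\<dots> = 1" by (intro sum_pmf_eq_1 near_uniform_vectorD(1) [OF nu]) auto
  finally have total: "(\<Sum>y\<in>vecs (?I - {i}). r y) = 1" .
  have inj: "inj_on (\<lambda>x. restrict x (?I - {i})) S"
  proof (rule inj_onI)
    fix x y assume xy: "x \<in> S" "y \<in> S" "restrict x (?I - {i}) = restrict y (?I - {i})"
    have xv: "x \<in> vecs ?I" "y \<in> vecs ?I" using xy by (auto simp: S_def)
    note [simp] = xv [THEN vecs_in] v [THEN vecs_in]
    have off: "x k = y k" if "k \<in> ?I - {i}" for k using fun_cong [OF xy(3), of k] that by simp
    have cl: "dot (?I - {i}) v y \<in> carrier K" unfolding dot_def by (intro finsum_closed) auto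
    have "dot (?I - {i}) v x = dot (?I - {i}) v y"
      unfolding dot_def using off by (intro finsum_cong') auto
    hence "v i \<otimes> x i \<oplus> dot (?I - {i}) v y = v i \<otimes> y i \<oplus> dot (?I - {i}) v y"
      using dot_remove [of ?I i v x] dot_remove [of ?I i v y] xy xv v i by (simp add: S_def)
    hence "v i \<otimes> x i = v i \<otimes> y i" using cl i by simp
    hence "x i = y i" using i m_lcancel [of "v i" "x i" "y i"] by simp
    thus "x = y" using off by (intro vec_eqI [OF xv]) blast
  qed
  have "measure_pmf.prob \<mu> {x. dot ?I v x = \<zero>} = measure_pmf.prob \<mu> S"
    by (rule measure_prob_cong_0) (use near_uniform_vectorD(1) [OF nu] in \<open>auto simp: S_def set_pmf_iff\<close>)
  also have "\<dots> = (\<Sum>x\<in>S. pmf \<mu> x)" using finS by (rule measure_measure_pmf_finite)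
  also have "\<dots> \<le> (\<Sum>x\<in>S. (C / q) * r (restrict x (?I - {i})))"
  proof (rule sum_mono)
    fix x assume "x \<in> S"
    hence "pmf \<mu> x = p i (x i) * r x" using fac by (simp add: S_def)
    also have "r x = r (restrict x (?I - {i}))" by (rule r_restrict) simp
    also have "p i (x i) * r (restrict x (?I - {i})) \<le> (C / q) * r (restrict x (?I - {i}))"
      unfolding p_def by (intro mult_right_mono near_uniform_vectorD(2) [OF nu i(1)] rpos)
    finally show "pmf \<mu> x \<le> (C / q) * r (restrict x (?I - {i}))" .
  qed
  also have "\<dots> = (C / q) * (\<Sum>y\<in>(\<lambda>x. restrict x (?I - {i})) ` S. r y)"
    unfolding sum.reindex [OF inj] o_def sum_distrib_left ..
  also have "\<dots> \<le> (C / q) * (\<Sum>y\<in>vecs (?I - {i}). r y)"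
  proof (intro mult_left_mono sum_mono2 rpos Cq)
    show "(\<lambda>x. restrict x (?I - {i})) ` S \<subseteq> vecs (?I - {i})"
      unfolding S_def restrict_PiE_iff using vecs_in by (intro image_subsetI restrict_PiE) auto
  qed simp_all
  finally show ?thesis using total by simp
qed

text \<open>
  For a uniformly random \<open>v\<close> the events \<open>v \<cdot> x = 0\<close> and \<open>v \<cdot> y = 0\<close> have probability \<open>1/q\<close> each and \<open>1/q\<^sup>2\<close>
  jointly: they are uncorrelated.
\<close>

lemma sum_centred_indicators_eq_0:
  assumes I: "finite I" and x: "x \<in> vecs I" "x \<noteq> zero_vec I" and y: "y \<in> vecs I"
    and indep: "\<And>c. c \<in> carrier K \<Longrightarrow> y \<noteq> (\<lambda>i\<in>I. c \<otimes> x i)"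
  shows "(\<Sum>v\<in>vecs I. (of_bool (dot I v x = \<zero>) - 1 / q) * (of_bool (dot I v y = \<zero>) - 1 / q)) = (0 :: real)"
proof -
  have "y \<noteq> zero_vec I"
  proof
    assume "y = zero_vec I"
    moreover have "(\<lambda>i\<in>I. \<zero> \<otimes> x i) = zero_vec I"
      unfolding zero_vec_def using vecs_in [OF x(1)] by (intro restrict_ext) simp
    ultimately show False using indep [OF zero_closed] by simp
  qed
  have q0: "real q \<noteq> 0" using q_ge_2 by simp
  have cnt: "(\<Sum>v\<in>vecs I. of_bool (P v)) = real (card {v \<in> vecs I. P v})" for P
    using I by (simp add: of_bool_def sum.inter_filter [symmetric])
  have 1: "real q * card {v \<in> vecs I. dot I v x = \<zero>} = real q ^ card I"
    using card_dot_eq_0 [OF I x] by (simp flip: of_nat_mult of_nat_power)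
  have 2: "real q * card {v \<in> vecs I. dot I v y = \<zero>} = real q ^ card I"
    using card_dot_eq_0 [OF I y \<open>y \<noteq> zero_vec I\<close>] by (simp flip: of_nat_mult of_nat_power)
  have 3: "(real q)\<^sup>2 * card {v \<in> vecs I. dot I v x = \<zero> \<and> dot I v y = \<zero>} = real q ^ card I"
    using card_two_annihilated [OF I x y indep] by (simp flip: of_nat_mult of_nat_power)
  let ?S = "\<Sum>v\<in>vecs I. (of_bool (dot I v x = \<zero>) - 1 / real q) * (of_bool (dot I v y = \<zero>) - 1 / real q)"
  have "?S = (\<Sum>v\<in>vecs I. of_bool (dot I v x = \<zero> \<and> dot I v y = \<zero>)
        - of_bool (dot I v x = \<zero>) / q - of_bool (dot I v y = \<zero>) / q + 1 / (real q)\<^sup>2)"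
    by (intro sum.cong refl) (auto simp: of_bool_def algebra_simps power2_eq_square)
  also have "\<dots> = real (card {v \<in> vecs I. dot I v x = \<zero> \<and> dot I v y = \<zero>})
      - real (card {v \<in> vecs I. dot I v x = \<zero>}) / q - real (card {v \<in> vecs I. dot I v y = \<zero>}) / q
      + real q ^ card I / (real q)\<^sup>2"
    by (simp only: sum.distrib sum_subtractf cnt sum_constant sum_divide_distrib [symmetric])
       (simp add: card_vec [OF I])
  finally have "(real q)\<^sup>2 * ?S = (real q)\<^sup>2 * card {v \<in> vecs I. dot I v x = \<zero> \<and> dot I v y = \<zero>}
      - real q * (real q * card {v \<in> vecs I. dot I v x = \<zero>}) / q
      - real q * (real q * card {v \<in> vecs I. dot I v y = \<zero>}) / q + real q ^ card I"
    using q0 by (simp only:) (simp add: algebra_simps power2_eq_square)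
  hence "(real q)\<^sup>2 * ?S = 0" unfolding 1 2 3 using q0 by simp
  thus ?thesis using q0 by simp
qed

text \<open>
  Writing the square of the bias with two independent copies \<open>x\<close>, \<open>y\<close> of the column and summing over \<open>v\<close>
  first, only pairs with \<open>x = 0\<close> or \<open>y\<close> a multiple of \<open>x\<close> contribute. For fixed \<open>x\<close> these are at most \<open>q\<close>
  values of \<open>y\<close>, each of probability at most \<open>\<beta>\<close>; the summand \<open>1\<close> in \<open>q + 1\<close> accounts for \<open>x = 0\<close>.
\<close>

lemma second_moment_bias:
  assumes I: "finite I" and supp: "set_pmf \<mu> \<subseteq> vecs I" and \<beta>: "\<And>w. pmf \<mu> w \<le> \<beta>"
  shows "(\<Sum>v\<in>vecs I. (measure_pmf.prob \<mu> {x. dot I v x = \<zero>} - 1 / q)\<^sup>2) \<le> real q ^ card I * ((real q + 1) * \<beta>)"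
proof -
  let ?V = "vecs I"
  have V: "finite ?V" using I by simp
  define m where "m = pmf \<mu>"
  define h where "h v x = of_bool (dot I v x = \<zero>) - 1 / real q" for v x
  define D where "D x y \<longleftrightarrow> x = zero_vec I \<or> (\<exists>c\<in>carrier K. y = (\<lambda>i\<in>I. c \<otimes> x i))" for x y
  have m0: "m x \<ge> 0" and mb: "m x \<le> \<beta>" for x by (simp_all add: m_def \<beta>)
  have m1: "(\<Sum>x\<in>?V. m x) = 1" unfolding m_def by (rule sum_pmf_eq_1 [OF V supp])
  have \<beta>0: "\<beta> \<ge> 0" using m0 mb order_trans by blast
  have q0: "real q > 0" "1 / real q \<le> 1" using q_ge_2 by auto
  have h1: "\<bar>h v x\<bar> \<le> 1" for v x using q0 by (auto simp: h_def of_bool_def)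
  have exp: "measure_pmf.prob \<mu> {x. dot I v x = \<zero>} - 1 / q = (\<Sum>x\<in>?V. m x * h v x)" for v
  proof -
    have "(\<Sum>x\<in>?V. m x * h v x) = (\<Sum>x\<in>?V. of_bool (dot I v x = \<zero>) * m x) - (\<Sum>x\<in>?V. m x) * (1 / q)"
      unfolding sum_distrib_right h_def by (simp only: right_diff_distrib sum_subtractf mult_ac)
    thus ?thesis using m1 prob_eq_sum_pmf [OF V supp, of "\<lambda>x. dot I v x = \<zero>"] by (simp add: m_def)
  qed
  have "(\<Sum>v\<in>?V. (measure_pmf.prob \<mu> {x. dot I v x = \<zero>} - 1 / q)\<^sup>2) =
      (\<Sum>v\<in>?V. \<Sum>x\<in>?V. \<Sum>y\<in>?V. m x * m y * (h v x * h v y))"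
    unfolding exp power2_eq_square sum_product by (simp add: mult_ac)
  also have "\<dots> = (\<Sum>x\<in>?V. \<Sum>v\<in>?V. \<Sum>y\<in>?V. m x * m y * (h v x * h v y))" by (rule sum.swap)
  also have "\<dots> = (\<Sum>x\<in>?V. \<Sum>y\<in>?V. \<Sum>v\<in>?V. m x * m y * (h v x * h v y))"
    by (intro sum.cong refl sum.swap)
  also have "\<dots> \<le> (\<Sum>x\<in>?V. \<Sum>y\<in>?V. m x * m y * (real q ^ card I * of_bool (D x y)))"
  proof (intro sum_mono)
    fix x y assume xy: "x \<in> ?V" "y \<in> ?V"
    have "(\<Sum>v\<in>?V. h v x * h v y) \<le> real q ^ card I * of_bool (D x y)"
    proof (cases "D x y")
      case True
      have "h v x * h v y \<le> 1" for v
        using mult_mono [OF h1 [of v x] h1 [of v y]] abs_ge_self [of "h v x * h v y"] by (simp add: abs_mult)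
      hence "(\<Sum>v\<in>?V. h v x * h v y) \<le> (\<Sum>v\<in>?V. 1)" by (intro sum_mono)
      thus ?thesis using True by (simp add: card_vec [OF I])
    next
      case False
      thus ?thesis
        using sum_centred_indicators_eq_0 [OF I xy(1) _ xy(2)] by (auto simp: D_def h_def)
    qed
    hence "m x * m y * (\<Sum>v\<in>?V. h v x * h v y) \<le> m x * m y * (real q ^ card I * of_bool (D x y))"
      by (intro mult_left_mono mult_nonneg_nonneg m0)
    thus "(\<Sum>v\<in>?V. m x * m y * (h v x * h v y)) \<le> m x * m y * (real q ^ card I * of_bool (D x y))"
      by (simp add: sum_distrib_left)
  qed
  also have "\<dots> = real q ^ card I * (\<Sum>x\<in>?V. m x * (\<Sum>y\<in>?V. of_bool (D x y) * m y))"
    by (simp add: sum_distrib_left mult_ac)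
  also have "(\<Sum>x\<in>?V. m x * (\<Sum>y\<in>?V. of_bool (D x y) * m y)) \<le>
      (\<Sum>x\<in>?V. m x * (of_bool (x = zero_vec I) + real q * \<beta>))"
  proof (intro sum_mono mult_left_mono m0)
    fix x assume "x \<in> ?V"
    show "(\<Sum>y\<in>?V. of_bool (D x y) * m y) \<le> of_bool (x = zero_vec I) + real q * \<beta>"
    proof (cases "x = zero_vec I")
      case True
      thus ?thesis using m1 \<beta>0 by (simp add: D_def)
    next
      case False
      let ?L = "(\<lambda>c. \<lambda>i\<in>I. c \<otimes> x i) ` carrier K"
      have "(\<Sum>y\<in>?V. of_bool (D x y) * m y) = (\<Sum>y\<in>?V \<inter> ?L. m y)"
        unfolding sum.inter_restrict [OF V] by (intro sum.cong) (use False in \<open>auto simp: D_def\<close>)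
      also have "\<dots> \<le> (\<Sum>y\<in>?L. m y)" by (intro sum_mono2) (auto simp: m0)
      also have "\<dots> \<le> real (card ?L) * \<beta>" by (intro sum_bounded_above mb)
      also have "\<dots> \<le> real q * \<beta>"
        by (intro mult_right_mono \<beta>0) (simp add: card_image_le)
      finally show ?thesis by (simp add: False)
    qed
  qed
  also have "\<dots> = (\<Sum>x\<in>?V. if x = zero_vec I then m x else 0) + real q * \<beta>"
  proof -
    have "(\<Sum>x\<in>?V. m x * (of_bool (x = zero_vec I) + real q * \<beta>)) =
        (\<Sum>x\<in>?V. (if x = zero_vec I then m x else 0) + m x * (real q * \<beta>))"
      by (intro sum.cong) (auto simp: algebra_simps)
    thus ?thesis by (simp add: sum.distrib m1 sum_distrib_right [symmetric])
  qed
  also have "\<dots> \<le> \<beta> + real q * \<beta>" using V by (simp add: sum.delta' mb)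
  finally show ?thesis using q0 by (simp add: algebra_simps mult_left_mono)
qed

text \<open>
  Chebyshev's inequality for the previous bound.
\<close>

lemma card_biased_le:
  assumes I: "finite I" and supp: "set_pmf \<mu> \<subseteq> vecs I" and \<beta>: "\<And>w. pmf \<mu> w \<le> \<beta>" and \<epsilon>: "\<epsilon> > 0"
  shows "real (card {v \<in> vecs I. \<epsilon> < \<bar>measure_pmf.prob \<mu> {x. dot I v x = \<zero>} - 1 / q\<bar>}) \<le>
    real q ^ card I * ((real q + 1) * \<beta>) / \<epsilon>\<^sup>2"
proof -
  let ?b = "\<lambda>v. measure_pmf.prob \<mu> {x. dot I v x = \<zero>} - 1 / q"
  let ?B = "{v \<in> vecs I. \<epsilon> < \<bar>?b v\<bar>}"
  have "real (card ?B) * \<epsilon>\<^sup>2 = (\<Sum>v\<in>?B. \<epsilon>\<^sup>2)" by simp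
  also have "\<dots> \<le> (\<Sum>v\<in>?B. (?b v)\<^sup>2)"
    using \<epsilon> by (intro sum_mono) (auto simp: abs_le_square_iff [symmetric])
  also have "\<dots> \<le> (\<Sum>v\<in>vecs I. (?b v)\<^sup>2)" using I by (intro sum_mono2) auto
  also have "\<dots> \<le> real q ^ card I * ((real q + 1) * \<beta>)" by (rule second_moment_bias [OF I supp \<beta>])
  finally show ?thesis using \<epsilon> by (simp add: field_simps)
qed

text \<open>
  For a fixed \<open>x\<close> the fraction of \<open>u \<in> U\<close> with \<open>u \<cdot> x = 0\<close> is \<open>1\<close> if \<open>x\<close> is orthogonal to \<open>U\<close> and \<open>1/q\<close>
  otherwise. Averaging over \<open>x\<close> turns the wanted probability into the mean of \<open>P(u \<cdot> x = 0)\<close> over \<open>U\<close>, where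
  \<open>u = 0\<close> contributes \<open>1\<close> and every other \<open>u\<close> about \<open>1/q\<close>. Since the error is a mean, it does not grow with
  the size of \<open>U\<close>. The factor \<open>2\<close> is \<open>1 / (1 - 1/q)\<close> for \<open>q = 2\<close>.
\<close>

lemma prob_orthogonal_to_subspace:
  assumes I: "finite I" and supp: "set_pmf \<mu> \<subseteq> vecs I" and U: "lin_closed I U"
    and good: "\<And>u. u \<in> U \<Longrightarrow> u \<noteq> zero_vec I \<Longrightarrow> \<bar>measure_pmf.prob \<mu> {x. dot I u x = \<zero>} - 1 / q\<bar> \<le> \<epsilon>"
    and \<epsilon>: "\<epsilon> \<ge> 0"
  shows "\<bar>measure_pmf.prob \<mu> {x. \<forall>u\<in>U. dot I u x = \<zero>} - 1 / card U\<bar> \<le> 2 * \<epsilon>"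
proof -
  let ?V = "vecs I" and ?p = "\<lambda>u. measure_pmf.prob \<mu> {x. dot I u x = \<zero>}"
  define P where "P = measure_pmf.prob \<mu> {x. \<forall>u\<in>U. dot I u x = \<zero>}"
  have V: "finite ?V" using I by simp
  have UV: "U \<subseteq> ?V" and U0: "zero_vec I \<in> U" using U by (auto simp: lin_closed_def)
  have finU: "finite U" using UV V finite_subset by blast
  have cU: "real (card U) > 0" using U0 finU by (auto simp: card_gt_0_iff)
  have q0: "real q \<ge> 2" using q_ge_2 by simp
  have m1: "(\<Sum>x\<in>?V. pmf \<mu> x) = 1" by (rule sum_pmf_eq_1 [OF V supp])
  have cnt: "(\<Sum>u\<in>U. of_bool (dot I u x = \<zero>)) =
      card U * (1 / q + (1 - 1 / q) * of_bool (\<forall>u\<in>U. dot I u x = \<zero>))" if x: "x \<in> ?V" for x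
  proof -
    have "(\<Sum>u\<in>U. of_bool (dot I u x = \<zero>)) = real (card {u \<in> U. dot I u x = \<zero>})"
      using finU by (simp add: of_bool_def sum.inter_filter [symmetric])
    also have "\<dots> = card U * (1 / q + (1 - 1 / q) * of_bool (\<forall>u\<in>U. dot I u x = \<zero>))"
    proof (cases "\<forall>u\<in>U. dot I u x = \<zero>")
      case True
      hence "{u \<in> U. dot I u x = \<zero>} = U" by auto
      thus ?thesis using True by simp
    next
      case False
      then obtain w where "w \<in> U" "dot I w x \<noteq> \<zero>" by auto
      hence "real (card U) = real q * card {u \<in> U. dot I u x = \<zero>}"
        using card_hyperplane [OF I U x] by simp
      hence "real (card {u \<in> U. dot I u x = \<zero>}) = card U * (1 / q)"
        using q0 by (simp add: field_simps)
      thus ?thesis using False by (simp only: of_bool_eq mult_zero_right add_0_right)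
    qed
    finally show ?thesis .
  qed
  have "(\<Sum>u\<in>U. ?p u) = (\<Sum>u\<in>U. \<Sum>x\<in>?V. of_bool (dot I u x = \<zero>) * pmf \<mu> x)"
    by (intro sum.cong refl prob_eq_sum_pmf V supp)
  also have "\<dots> = (\<Sum>x\<in>?V. (\<Sum>u\<in>U. of_bool (dot I u x = \<zero>)) * pmf \<mu> x)"
    by (subst sum.swap) (simp add: sum_distrib_right)
  also have "\<dots> = (\<Sum>x\<in>?V. card U * (1 / q + (1 - 1 / q) * of_bool (\<forall>u\<in>U. dot I u x = \<zero>)) * pmf \<mu> x)"
    by (intro sum.cong refl) (simp only: cnt)
  also have "\<dots> = card U * ((1 / q) * (\<Sum>x\<in>?V. pmf \<mu> x) +
      (1 - 1 / q) * (\<Sum>x\<in>?V. of_bool (\<forall>u\<in>U. dot I u x = \<zero>) * pmf \<mu> x))"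
    by (simp only: distrib_left distrib_right sum.distrib sum_distrib_left mult_ac)
  also have "\<dots> = card U * (1 / q + (1 - 1 / q) * P)"
    unfolding P_def m1 prob_eq_sum_pmf [OF V supp] by simp
  finally have avg: "(\<Sum>u\<in>U. ?p u) = card U * (1 / q + (1 - 1 / q) * P)" .
  have p0: "?p (zero_vec I) = 1"
    unfolding prob_eq_sum_pmf [OF V supp] using m1 by (simp cong: sum.cong)
  have "(\<Sum>u\<in>U. ?p u - 1 / q) = (1 - 1 / q) + (\<Sum>u\<in>U - {zero_vec I}. ?p u - 1 / q)"
    using sum.remove [OF finU U0, of "\<lambda>u. ?p u - 1 / q"] p0 by simp
  then have "card U * (1 - 1 / q) * (P - 1 / card U) = (\<Sum>u\<in>U - {zero_vec I}. ?p u - 1 / q)"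
  proof -
    assume *: "(\<Sum>u\<in>U. ?p u - 1 / q) = (1 - 1 / q) + (\<Sum>u\<in>U - {zero_vec I}. ?p u - 1 / q)"
    have "(\<Sum>u\<in>U. ?p u - 1 / q) = (\<Sum>u\<in>U. ?p u) - card U * (1 / q)"
      by (simp only: sum_subtractf sum_constant)
    also have "\<dots> = card U * (1 - 1 / q) * P" unfolding avg by (simp only: distrib_left)
    also have "\<dots> - (1 - 1 / q) = card U * (1 - 1 / q) * (P - 1 / card U)"
    proof -
      have "card U * (1 - 1 / q) * (1 / card U) = 1 - 1 / q" using cU by simp
      thus ?thesis unfolding right_diff_distrib [of _ P] by (simp only:)
    qed
    finally show ?thesis using * by simp
  qed
  also have "\<bar>\<dots>\<bar> \<le> (\<Sum>u\<in>U - {zero_vec I}. \<epsilon>)"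
    by (rule order_trans [OF sum_abs], rule sum_mono, rule good) auto
  also have "\<dots> \<le> card U * \<epsilon>"
    using \<epsilon> finU by (simp add: mult_right_mono card_mono)
  finally have "card U * ((1 - 1 / q) * \<bar>P - 1 / card U\<bar>) \<le> card U * \<epsilon>"
    using q0 by (simp add: abs_mult)
  hence *: "(1 - 1 / q) * \<bar>P - 1 / card U\<bar> \<le> \<epsilon>" using cU by simp
  have "1 / 2 * \<bar>P - 1 / card U\<bar> \<le> (1 - 1 / q) * \<bar>P - 1 / card U\<bar>"
    using q0 by (intro mult_right_mono) (auto simp: field_simps)
  from order_trans [OF this *] have "2 * (1 / 2 * \<bar>P - 1 / card U\<bar>) \<le> 2 * \<epsilon>" by simp
  thus ?thesis by (simp add: P_def)
qed

end

section \<open>The corank chain and its limit\<close>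

text \<open>
  The dimension of the left kernel while \<open>s\<close> uniform columns are added, started at \<open>d\<close>, for \<open>x = 1/q\<close>. A
  uniform column is orthogonal to a space of dimension \<open>d\<close> with probability \<open>x\<^sup>d\<close>; in particular \<open>0\<close> is
  absorbing, so the truncated subtraction is harmless.
\<close>

primrec corank_chain :: "real \<Rightarrow> nat \<Rightarrow> nat \<Rightarrow> nat pmf" where
  "corank_chain x 0 d = return_pmf d"
| "corank_chain x (Suc s) d = bind_pmf (bernoulli_pmf (x ^ d))
     (\<lambda>b. corank_chain x s (if b then d else d - 1))"

lemma prob_bind_pmf:
  "measure_pmf.prob (bind_pmf p f) A = measure_pmf.expectation p (\<lambda>x. measure_pmf.prob (f x) A)"
  unfolding measure_pmf_bind
  by (rule measure_pmf.measure_bind [where N = "count_space UNIV"])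
     (auto simp: measure_pmf_in_subprob_algebra)

lemma prob_corank_chain_Suc:
  assumes "0 \<le> x" "x \<le> 1"
  shows "measure_pmf.prob (corank_chain x (Suc s) d) A =
    x ^ d * measure_pmf.prob (corank_chain x s d) A +
    (1 - x ^ d) * measure_pmf.prob (corank_chain x s (d - 1)) A"
  using assms unfolding corank_chain.simps prob_bind_pmf
  by (subst integral_bernoulli_pmf) (auto intro: power_le_one)

lemma pmf_corank_chain_Suc:
  assumes "0 \<le> x" "x \<le> 1"
  shows "pmf (corank_chain x (Suc s) d) k =
    x ^ d * pmf (corank_chain x s d) k + (1 - x ^ d) * pmf (corank_chain x s (d - 1)) k"
  using prob_corank_chain_Suc [OF assms, of s d "{k}"] by (simp only: measure_pmf_single)

lemma pmf_corank_chain_gt: "d < k \<Longrightarrow> pmf (corank_chain x s d) k = 0"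
proof (induction s arbitrary: d)
  case (Suc s)
  have "k \<notin> set_pmf (corank_chain x s (if b then d else d - 1))" for b
    using Suc.IH [of "if b then d else d - 1"] Suc.prems by (auto simp: set_pmf_eq)
  thus ?case by (auto simp: set_pmf_eq [symmetric] pmf_eq_0_set_pmf)
qed simp

text \<open>
  The probability that a uniform \<open>s \<times> d\<close> matrix over the field with \<open>1/x\<close> elements has rank \<open>r\<close>. For
  \<open>r > s\<close> the factor with \<open>i = s\<close> vanishes, so the truncated \<open>s - i\<close> and \<open>s - r\<close> do no harm.
\<close>

definition rank_mass :: "real \<Rightarrow> nat \<Rightarrow> nat \<Rightarrow> nat \<Rightarrow> real" where
  "rank_mass x s d r = x ^ ((s - r) * (d - r)) *
     (\<Prod>i<r. (1 - x ^ (s - i)) * (1 - x ^ (d - i)) / (1 - x ^ Suc i))"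

lemma rank_mass_eq_0: "s < r \<Longrightarrow> rank_mass x s d r = 0"
  unfolding rank_mass_def by (subst prod_zero [of "{..<r}"]) (auto intro!: bexI [of _ s])

text \<open>
  After the common factors are cancelled this is
  \<open>1 - x\<^bsup>s+1\<^esup> = x\<^bsup>r+1\<^esup> (1 - x\<^bsup>s-r\<^esup>) + (1 - x\<^bsup>r+1\<^esup>)\<close>. It is the recursion of the chain, conditioned on its
  first step and indexed by the rank \<open>d - k\<close> instead of the corank \<open>k\<close>.
\<close>

lemma rank_mass_step:
  assumes x: "0 < x" "x < 1" and r: "Suc r \<le> d"
  shows "rank_mass x (Suc s) d (Suc r) =
    x ^ d * rank_mass x s d (Suc r) + (1 - x ^ d) * rank_mass x s (d - 1) r"
proof (cases "r \<le> s")
  case False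
  thus ?thesis by (simp add: rank_mass_eq_0)
next
  case rs: True
  define B where "B = (\<Prod>i<r. 1 - x ^ (s - i))"
  define D where "D = (\<Prod>i<r. 1 - x ^ (d - 1 - i))"
  define E where "E = (\<Prod>i<r. 1 - x ^ Suc i)"
  have E: "E \<noteq> 0" "1 - x ^ Suc r \<noteq> 0"
    using x power_less_one_iff [of x] unfolding E_def 
    by (auto simp: less_imp_neq power_Suc_less_one simp del: power_Suc)
  have shift: "(\<Prod>i<Suc r. 1 - x ^ (Suc s - i)) = (1 - x ^ Suc s) * B"
      "(\<Prod>i<Suc r. 1 - x ^ (d - i)) = (1 - x ^ d) * D"
    unfolding B_def D_def using r
    by (simp_all add: prod.lessThan_Suc_shift del: prod.lessThan_Suc power_Suc)
  have 1: "rank_mass x (Suc s) d (Suc r) =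
      x ^ ((s - r) * (d - Suc r)) * ((1 - x ^ Suc s) * B * ((1 - x ^ d) * D) / (E * (1 - x ^ Suc r)))"
    unfolding rank_mass_def prod_dividef prod.distrib shift by (simp add: E_def)
  have 2: "rank_mass x s d (Suc r) =
      x ^ ((s - Suc r) * (d - Suc r)) * ((B * (1 - x ^ (s - r))) * ((1 - x ^ d) * D) / (E * (1 - x ^ Suc r)))"
    unfolding rank_mass_def prod_dividef prod.distrib shift by (simp add: E_def B_def)
  have 3: "rank_mass x s (d - 1) r = x ^ ((s - r) * (d - Suc r)) * (B * D / E)"
    unfolding rank_mass_def prod_dividef prod.distrib by (simp add: E_def B_def D_def)
  have pw: "x ^ d * (x ^ ((s - Suc r) * (d - Suc r)) * (1 - x ^ (s - r))) =
      x ^ ((s - r) * (d - Suc r)) * (x ^ Suc r * (1 - x ^ (s - r)))"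
  proof (cases "s = r")
    case False
    then obtain t where t: "s = Suc (r + t)" using rs by (metis le_neq_implies_less less_iff_Suc_add)
    obtain e where e: "d = Suc r + e" using r le_Suc_ex by blast
    show ?thesis by (simp add: t e power_add power_mult algebra_simps)
  qed simp
  have sr: "x ^ Suc r * x ^ (s - r) = x ^ Suc s"
    using rs by (simp flip: power_add add: mult.assoc)
  define W where "W = B * ((1 - x ^ d) * D) / (E * (1 - x ^ Suc r))"
  have "x ^ d * rank_mass x s d (Suc r) =
      (x ^ d * (x ^ ((s - Suc r) * (d - Suc r)) * (1 - x ^ (s - r)))) * W"
    unfolding 2 W_def by simp
  also have "\<dots> = x ^ ((s - r) * (d - Suc r)) * (x ^ Suc r - x ^ Suc s) * W"
    unfolding pw using sr by (simp only: right_diff_distrib mult_1_right mult.assoc)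
  finally have "x ^ d * rank_mass x s d (Suc r) =
      x ^ ((s - r) * (d - Suc r)) * (x ^ Suc r - x ^ Suc s) * W" .
  moreover have "(1 - x ^ d) * rank_mass x s (d - 1) r =
      x ^ ((s - r) * (d - Suc r)) * (1 - x ^ Suc r) * W"
    using E unfolding 3 W_def by (simp add: field_simps del: power_Suc)
  moreover have "rank_mass x (Suc s) d (Suc r) =
      x ^ ((s - r) * (d - Suc r)) * (1 - x ^ Suc s) * W"
    unfolding 1 W_def by simp
  ultimately show ?thesis by argo
qed

lemma pmf_corank_chain:
  assumes x: "0 < x" "x < 1" and r: "r \<le> d"
  shows "pmf (corank_chain x s d) (d - r) = rank_mass x s d r"
  using r
proof (induction s arbitrary: d r)
  case 0
  show ?case
  proof (cases "r = 0")
    case True thus ?thesis by (simp add: rank_mass_def)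
  next
    case False thus ?thesis using 0 by (simp add: rank_mass_eq_0)
  qed
next
  case (Suc s)
  have x': "0 \<le> x" "x \<le> 1" using x by auto
  show ?case
  proof (cases r)
    case 0
    have "(1 - x ^ d) * pmf (corank_chain x s (d - 1)) d = 0"
      by (cases d) (simp_all add: pmf_corank_chain_gt)
    moreover have "pmf (corank_chain x s d) d = rank_mass x s d 0" using Suc.IH [of 0 d] by simp
    ultimately show ?thesis
      unfolding pmf_corank_chain_Suc [OF x'] 0 by (simp add: rank_mass_def power_add)
  next
    case (Suc r')
    have "d - Suc r' = d - 1 - r'" by simp
    hence "pmf (corank_chain x s (d - 1)) (d - Suc r') = rank_mass x s (d - 1) r'"
      using Suc.IH [of r' "d - 1"] Suc.prems \<open>r = Suc r'\<close> by simp
    thus ?thesis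
      using rank_mass_step [OF x, of r' d s] Suc.IH [of r d] Suc.prems \<open>r = Suc r'\<close>
      unfolding pmf_corank_chain_Suc [OF x'] by simp
  qed
qed

text \<open>
  From \<open>n + 1\<close> with \<open>n + 1\<close> steps to go, the first step leads to \<open>n\<close> with \<open>n\<close> steps to go, except with
  probability \<open>x\<^bsup>n+1\<^esup>\<close>. The right-hand side bounds the resulting geometric sum for \<open>x \<le> 1/2\<close> and is
  written as a difference so that it telescopes.
\<close>

lemma corank_chain_cauchy:
  assumes x: "0 < x" "x \<le> 1 / 2"
  shows "\<bar>measure_pmf.prob (corank_chain x (l + m) (l + m)) A -
          measure_pmf.prob (corank_chain x l l) A\<bar> \<le> 2 * (x ^ Suc l - x ^ Suc (l + m))"
proof (induction m)
  case (Suc m)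
  let ?n = "l + m"
  let ?P = "\<lambda>s d. measure_pmf.prob (corank_chain x s d) A"
  have "?P (Suc ?n) (Suc ?n) - ?P ?n ?n = x ^ Suc ?n * (?P ?n (Suc ?n) - ?P ?n ?n)"
    using x by (subst prob_corank_chain_Suc) (simp_all add: algebra_simps)
  also have "\<bar>\<dots>\<bar> \<le> x ^ Suc ?n * 1"
  proof -
    have "\<bar>?P ?n (Suc ?n) - ?P ?n ?n\<bar> \<le> 1"
      using measure_nonneg [of _ A] measure_pmf.prob_le_1 [of _ A] 
      by (smt (verit, best))
    thus ?thesis unfolding abs_mult using x by (intro mult_mono) simp_all
  qed
  also have "\<dots> \<le> 2 * (x ^ Suc ?n - x ^ Suc (Suc ?n))"
    using x mult_right_mono [of x "1/2" "x ^ Suc ?n"] by simp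
  finally show ?case using Suc by simp
qed simp

lemma q_product_has_prod:
  assumes x: "0 < x" "x < (1::real)"
  shows "(\<lambda>n. \<Prod>i<n. 1 - x ^ (k + 1 + i)) \<longlonglongrightarrow> (\<Prod>i. 1 - x ^ (k + 1 + i))"
    and "(\<Prod>i. 1 - x ^ (k + 1 + i)) \<noteq> 0"
proof -
  have "summable (\<lambda>i. x ^ (k + 1) * x ^ i)"
    using x by (intro summable_mult summable_geometric) simp
  moreover have "norm (1 - x ^ (k + 1 + i) - 1) = x ^ (k + 1) * x ^ i" for i
    using x by (simp add: power_add)
  ultimately have "abs_convergent_prod (\<lambda>i. 1 - x ^ (k + 1 + i))"
    by (intro summable_imp_abs_convergent_prod) (simp only:)
  hence c: "convergent_prod (\<lambda>i. 1 - x ^ (k + 1 + i))"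
    by (rule abs_convergent_prod_imp_convergent_prod)
  have nz: "1 - x ^ (k + 1 + i) \<noteq> 0" for i
    using x power_Suc_less_one [of x "k + i"] by auto
  show "(\<lambda>n. \<Prod>i<n. 1 - x ^ (k + 1 + i)) \<longlonglongrightarrow> (\<Prod>i. 1 - x ^ (k + 1 + i))"
    using convergent_prod_LIMSEQ [OF c]
    by (subst filterlim_sequentially_Suc [symmetric]) (simp only: lessThan_Suc_atMost)
  show "(\<Prod>i. 1 - x ^ (k + 1 + i)) \<noteq> 0"
    using c nz by (intro prodinf_nonzero)
qed

text \<open>
  With \<open>P\<^sub>j(m) = (1 - x\<^bsup>j+1\<^esup>) \<dots> (1 - x\<^bsup>j+m\<^esup>)\<close> the closed formula for \<open>l = k + m\<close> becomes
  \<open>x\<^bsup>k*k\<^esup> P\<^sub>k(m)\<^sup>2 / P\<^sub>0(m)\<close>, and \<open>P\<^sub>0(\<infinity>)\<close> is \<open>P\<^sub>k(\<infinity>)\<close> times the finite product over \<open>i \<le> k\<close>.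
\<close>

lemma pmf_corank_chain_limit:
  fixes q :: nat
  assumes q: "q \<ge> 2"
  shows "(\<lambda>l. pmf (corank_chain (1 / q) l l) k) \<longlonglongrightarrow> Q_infinity_mass q k"
proof -
  define x where "x = 1 / real q"
  have x: "0 < x" "x < 1" using q by (auto simp: x_def)
  define P where "P j m = (\<Prod>i<m. 1 - x ^ (j + 1 + i))" for j m
  define T where "T j = (\<Prod>i. 1 - x ^ (j + 1 + i))" for j
  have lim: "P j \<longlonglongrightarrow> T j" and T0: "T j \<noteq> 0" for j
    using q_product_has_prod [OF x, of j] unfolding P_def T_def by blast+
  define H where "H = (\<Prod>i<k. 1 - x ^ Suc i)"
  have split: "P 0 (k + m) = H * P k m" for m
    by (induction m) (simp_all add: P_def H_def mult_ac)
  have "T 0 = H * T k"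
  proof (rule LIMSEQ_unique)
    show "(\<lambda>m. P 0 (k + m)) \<longlonglongrightarrow> T 0"
      using LIMSEQ_ignore_initial_segment [OF lim [of 0], of k] by (simp add: add.commute)
    show "(\<lambda>m. P 0 (k + m)) \<longlonglongrightarrow> H * T k"
      unfolding split by (intro tendsto_intros lim)
  qed
  moreover have "(\<Prod>i = 1..k. 1 - 1 / real q ^ i) = H"
    unfolding H_def by (rule prod.reindex_bij_witness [of _ Suc "\<lambda>i. i - 1"])
       (auto simp: x_def power_divide)
  moreover have "T k = (\<Prod>i. 1 - 1 / real q ^ (k + 1 + i))"
    unfolding T_def x_def by (simp only: power_divide power_one)
  ultimately have Q: "Q_infinity_mass q k = x ^ (k * k) * (T k * T k / T 0)"
    unfolding Q_infinity_mass_def using T0 [of 0] T0 [of k]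
    by (simp add: x_def power2_eq_square power_divide)
  have pmf: "pmf (corank_chain x (m + k) (m + k)) k = x ^ (k * k) * (P k m * P k m / P 0 m)" for m
  proof -
    have rev: "(\<Prod>i<m. 1 - x ^ (m + k - i)) = P k m"
    proof -
      have "(\<Prod>i<m. 1 - x ^ (m + k - i)) = (\<Prod>i<m. 1 - x ^ (k + 1 + (m - Suc i)))"
      proof (intro prod.cong refl)
        fix i assume "i \<in> {..<m}"
        hence "m + k - i = k + 1 + (m - Suc i)" by simp
        thus "1 - x ^ (m + k - i) = 1 - x ^ (k + 1 + (m - Suc i))" by (simp only:)
      qed
      also have "\<dots> = P k m"
        unfolding P_def by (rule prod.nat_diff_reindex)
      finally show ?thesis .
    qed
    have "pmf (corank_chain x (m + k) (m + k)) k = rank_mass x (m + k) (m + k) m"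
      using pmf_corank_chain [OF x, of m "m + k" "m + k"] by simp
    thus ?thesis
      unfolding rank_mass_def prod_dividef prod.distrib rev by (simp add: P_def)
  qed
  have "(\<lambda>m. pmf (corank_chain x (m + k) (m + k)) k) \<longlonglongrightarrow> Q_infinity_mass q k"
    unfolding pmf Q by (intro tendsto_intros lim T0)
  thus ?thesis unfolding x_def by (rule LIMSEQ_offset)
qed

lemma Q_infinity_mass_nonneg:
  assumes q: "q \<ge> 2"
  shows "Q_infinity_mass q k \<ge> 0"
  by (rule LIMSEQ_le_const [OF pmf_corank_chain_limit [OF q]]) auto

lemma sum_Q_infinity_mass_le_1:
  assumes q: "q \<ge> 2" and F: "finite F"
  shows "sum (Q_infinity_mass q) F \<le> 1"
proof (rule LIMSEQ_le_const2)
  show "(\<lambda>l. \<Sum>k\<in>F. pmf (corank_chain (1 / q) l l) k) \<longlonglongrightarrow> sum (Q_infinity_mass q) F"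
    by (intro tendsto_sum pmf_corank_chain_limit q)
  show "\<exists>N. \<forall>l\<ge>N. (\<Sum>k\<in>F. pmf (corank_chain (1 / q) l l) k) \<le> 1"
    using F by (auto simp flip: measure_measure_pmf_finite)
qed

lemma emeasure_Q_infinity_finite:
  assumes q: "q \<ge> 2" and F: "finite F"
  shows "emeasure (Q_infinity q) F = ennreal (sum (Q_infinity_mass q) F)"
proof -
  have "emeasure (Q_infinity q) F = (\<Sum>k\<in>F. ennreal (Q_infinity_mass q k))"
    unfolding Q_infinity_def using F
    by (subst point_measure_def [symmetric]) (simp add: emeasure_point_measure_finite2)
  thus ?thesis using Q_infinity_mass_nonneg [OF q] by simp
qed

lemma sets_Q_infinity [simp]: "sets (Q_infinity q) = UNIV"
  by (simp add: Q_infinity_def)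

text \<open>
  Finite partial sums of the masses are limits of probabilities, so the total mass is at most \<open>1\<close>.
\<close>

lemma subprob_space_Q_infinity:
  assumes q: "q \<ge> 2"
  shows "subprob_space (Q_infinity q)"
proof
  have "emeasure (Q_infinity q) (\<Union>N. {..<N}) \<le> 1"
  proof (subst SUP_emeasure_incseq [symmetric])
    show "(SUP N. emeasure (Q_infinity q) {..<N}) \<le> 1"
      using sum_Q_infinity_mass_le_1 [OF q] emeasure_Q_infinity_finite [OF q]
      by (intro SUP_least) (simp add: ennreal_le_1)
  qed (auto simp: incseq_def)
  also have "(\<Union>N::nat. {..<N}) = space (Q_infinity q)"
    by (auto simp: Q_infinity_def)
  finally show "emeasure (Q_infinity q) (space (Q_infinity q)) \<le> 1" .
qed (simp add: Q_infinity_def)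

text \<open>
  For finite sets the bound is the limit of \<open>corank_chain_cauchy\<close>; an arbitrary \<open>A\<close> is exhausted by the
  finite sets \<open>A \<inter> {..<N}\<close>, along which both measures converge.
\<close>

lemma corank_chain_vs_Q_infinity:
  assumes q: "q \<ge> 2"
  shows "\<bar>measure_pmf.prob (corank_chain (1 / q) l l) A - measure (Q_infinity q) A\<bar> \<le> 2 * (1 / q) ^ Suc l"
proof -
  let ?p = "\<lambda>l. measure_pmf.prob (corank_chain (1 / q) l l)" and ?Q = "Q_infinity_mass q"
  interpret Q: subprob_space "Q_infinity q" by (rule subprob_space_Q_infinity [OF q])
  have x: "0 < 1 / real q" "1 / real q \<le> 1 / 2" using q by auto
  have fin: "\<bar>?p l F - measure (Q_infinity q) F\<bar> \<le> 2 * (1 / q) ^ Suc l" if F: "finite F" for F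
  proof (rule LIMSEQ_le_const2)
    have "measure (Q_infinity q) F = sum ?Q F"
      unfolding measure_def emeasure_Q_infinity_finite [OF q F]
      using Q_infinity_mass_nonneg [OF q] by (intro enn2real_ennreal sum_nonneg)
    moreover have "(\<lambda>m. \<Sum>k\<in>F. pmf (corank_chain (1 / q) (m + l) (m + l)) k) \<longlonglongrightarrow> sum ?Q F"
      by (intro tendsto_sum LIMSEQ_ignore_initial_segment pmf_corank_chain_limit q)
    ultimately show "(\<lambda>m. \<bar>?p l F - ?p (m + l) F\<bar>) \<longlonglongrightarrow> \<bar>?p l F - measure (Q_infinity q) F\<bar>"
      using F by (intro tendsto_intros) (simp add: measure_measure_pmf_finite)
    have "\<bar>?p l F - ?p (m + l) F\<bar> \<le> 2 * (1 / q) ^ Suc l" for m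
    proof -
      have "2 * ((1 / real q) ^ Suc l - (1 / real q) ^ Suc (l + m)) \<le> 2 * (1 / real q) ^ Suc l"
        by (intro mult_left_mono) (simp_all only: diff_le_eq le_add_same_cancel1, simp_all)
      from order_trans [OF corank_chain_cauchy [OF x, of l m F] this] show ?thesis
        unfolding add.commute [of m l] abs_minus_commute [of "?p l F"] .
    qed
    thus "\<exists>N. \<forall>m\<ge>N. \<bar>?p l F - ?p (m + l) F\<bar> \<le> 2 * (1 / q) ^ Suc l" by blast
  qed
  have incr: "incseq (\<lambda>N. A \<inter> {..<N})" by (auto simp: incseq_def)
  have UN: "(\<Union>N. A \<inter> {..<N}) = A" by auto
  have "(\<lambda>N. \<bar>?p l (A \<inter> {..<N}) - measure (Q_infinity q) (A \<inter> {..<N})\<bar>)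
      \<longlonglongrightarrow> \<bar>?p l (\<Union>N. A \<inter> {..<N}) - measure (Q_infinity q) (\<Union>N. A \<inter> {..<N})\<bar>"
    by (intro tendsto_intros measure_pmf.finite_Lim_measure_incseq Q.finite_Lim_measure_incseq incr) auto
  thus ?thesis
    unfolding UN by (rule LIMSEQ_le_const2) (intro exI allI impI fin, simp)
qed

lemma tv_dist_Q_infinity_leI:
  fixes p :: "nat pmf"
  assumes "\<And>A. \<bar>measure_pmf.prob p A - measure (Q_infinity q) A\<bar> \<le> b"
  shows "tv_dist p (Q_infinity q) \<le> b"
  unfolding tv_dist_def by (rule cSUP_least) (use assms in auto)

lemma tv_dist_Q_infinity_le_1:
  fixes p :: "nat pmf"
  assumes q: "q \<ge> 2"
  shows "tv_dist p (Q_infinity q) \<le> 1"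
proof (rule tv_dist_Q_infinity_leI)
  fix A
  interpret Q: subprob_space "Q_infinity q" by (rule subprob_space_Q_infinity [OF q])
  have "0 \<le> measure (Q_infinity q) A" "measure (Q_infinity q) A \<le> 1"
    by (simp_all add: Q.subprob_measure_le_1)
  moreover have "0 \<le> measure_pmf.prob p A" "measure_pmf.prob p A \<le> 1" by auto
  ultimately show "\<bar>measure_pmf.prob p A - measure (Q_infinity q) A\<bar> \<le> 1" by linarith
qed

section \<open>Revealing the columns\<close>

lemma integrable_prob_pmf [simp]:
  "integrable (measure_pmf p) (\<lambda>x. measure_pmf.prob (f x) (A x))"
  by (rule measure_pmf.integrable_const_bound [where B = 1]) auto

lemma integrable_indicator_pmf [simp]: "integrable (measure_pmf p) (indicator A :: _ \<Rightarrow> real)"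
  by (intro integrable_real_indicator) (auto simp: less_top [symmetric])

lemma expectation_close:
  fixes f g :: "'a \<Rightarrow> real"
  assumes f: "integrable (measure_pmf p) f" and g: "integrable (measure_pmf p) g"
    and c: "\<And>x. x \<in> set_pmf p \<Longrightarrow> \<bar>f x - g x\<bar> \<le> c"
  shows "\<bar>measure_pmf.expectation p f - measure_pmf.expectation p g\<bar> \<le> c"
proof -
  have fg: "integrable (measure_pmf p) (\<lambda>x. f x - g x)" using f g by simp
  have "measure_pmf.expectation p (\<lambda>x. f x - g x) \<le> c"
    by (rule measure_pmf.integral_le_const [OF fg])
       (use c in \<open>auto simp: AE_measure_pmf_iff abs_le_iff\<close>)
  moreover have "-c \<le> measure_pmf.expectation p (\<lambda>x. f x - g x)"
    by (rule measure_pmf.integral_ge_const [OF fg])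
       (use c in \<open>fastforce simp: AE_measure_pmf_iff abs_le_iff\<close>)
  ultimately show ?thesis using f g by (simp add: abs_le_iff)
qed

lemma prob_Pi_pmf_insert:
  assumes "finite J" "j \<notin> J"
  shows "measure_pmf.prob (Pi_pmf (insert j J) d \<mu>) E =
      measure_pmf.expectation (\<mu> j) (\<lambda>x. measure_pmf.prob (Pi_pmf J d \<mu>) {M. M(j := x) \<in> E})" (is ?A)
    and "measure_pmf.prob (Pi_pmf (insert j J) d \<mu>) E =
      measure_pmf.expectation (Pi_pmf J d \<mu>) (\<lambda>M. measure_pmf.prob (\<mu> j) {x. M(j := x) \<in> E})" (is ?B)
proof -
  have "Pi_pmf (insert j J) d \<mu> = bind_pmf (\<mu> j) (\<lambda>x. map_pmf (\<lambda>M. M(j := x)) (Pi_pmf J d \<mu>))"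
    using assms by (simp add: Pi_pmf_insert' map_pmf_def)
  thus ?A by (simp add: prob_bind_pmf vimage_def)
  have "Pi_pmf (insert j J) d \<mu> = bind_pmf (Pi_pmf J d \<mu>) (\<lambda>M. map_pmf (\<lambda>x. M(j := x)) (\<mu> j))"
    using assms by (simp add: Pi_pmf_insert' map_pmf_def bind_commute_pmf [of "\<mu> j"])
  thus ?B by (simp add: prob_bind_pmf vimage_def)
qed

lemma prob_Pi_pmf_union:
  assumes "finite J" "finite J'" "J \<inter> J' = {}"
  shows "measure_pmf.prob (Pi_pmf (J \<union> J') d \<mu>) E =
    measure_pmf.expectation (Pi_pmf J d \<mu>)
      (\<lambda>M. measure_pmf.prob (Pi_pmf J' d \<mu>) {M'. (\<lambda>j. if j \<in> J then M j else M' j) \<in> E})"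
proof -
  have "Pi_pmf (J \<union> J') d \<mu> = bind_pmf (Pi_pmf J d \<mu>)
      (\<lambda>M. map_pmf (\<lambda>M' j. if j \<in> J then M j else M' j) (Pi_pmf J' d \<mu>))"
    using assms by (simp add: Pi_pmf_union pair_pmf_def map_pmf_def bind_assoc_pmf bind_return_pmf)
  thus ?thesis by (simp add: prob_bind_pmf vimage_def)
qed

context finite_field
begin

lemma singleton_eqI: "z \<in> S \<Longrightarrow> (\<And>a. a \<in> S \<Longrightarrow> a = z) \<Longrightarrow> S = {z}"
  by blast

lemma annihilated_Un: "annihilated I U (J \<union> J') M = annihilated I (annihilated I U J M) J' M"
  by (auto simp: annihilated_def)

lemma annihilated_cong:
  "(\<And>j. j \<in> J \<Longrightarrow> M j = M' j) \<Longrightarrow> annihilated I U J M = annihilated I U J M'"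
  by (simp add: annihilated_def)

lemma set_Pi_pmf_columns:
  assumes "finite J" "\<And>j. j \<in> J \<Longrightarrow> set_pmf (\<mu> j) \<subseteq> vecs I" "M \<in> set_pmf (Pi_pmf J d \<mu>)" "j \<in> J"
  shows "M j \<in> vecs I"
proof -
  have "M j \<in> set_pmf (\<mu> j)"
    using assms(1,3,4) by (simp add: set_Pi_pmf PiE_dflt_def)
  thus ?thesis using assms(2,4) by blast
qed

text \<open>
  Given the other columns, a relation with coefficient \<open>1\<close> at \<open>j\<close> leaves one possible value for the \<open>j\<close>-th
  column.
\<close>

lemma prob_fixed_relation_le:
  assumes J: "finite J" and j: "j \<in> J" and a: "a \<in> vecs J" "a j = \<one>"
    and supp: "\<And>j. j \<in> J \<Longrightarrow> set_pmf (\<mu> j) \<subseteq> vecs I" and \<beta>: "\<And>w. pmf (\<mu> j) w \<le> \<beta>"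
  shows "measure_pmf.prob (Pi_pmf J d \<mu>) {M. \<forall>i\<in>I. dot J a (\<lambda>j\<in>J. M j i) = \<zero>} \<le> \<beta>"
proof -
  let ?J = "J - {j}"
  let ?E = "{M. \<forall>i\<in>I. dot J a (\<lambda>j\<in>J. M j i) = \<zero>}"
  have Jeq: "J = insert j ?J" using j by auto
  have \<beta>0: "0 \<le> \<beta>" using \<beta> pmf_nonneg order_trans by metis
  have bound: "measure_pmf.prob (\<mu> j) {x. M(j := x) \<in> ?E} \<le> \<beta>" if M: "M \<in> set_pmf (Pi_pmf ?J d \<mu>)" for M
  proof -
    have Mv: "M k \<in> vecs I" if "k \<in> ?J" for k
      using J supp that by (intro set_Pi_pmf_columns [OF _ _ M that]) auto
    define e where "e i = dot ?J a (\<lambda>k\<in>?J. M k i)" for i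
    have e: "e i \<in> carrier K" if "i \<in> I" for i
      unfolding e_def dot_def using vecs_in [OF Mv] vecs_in [OF a(1)] that
      by (intro finsum_closed) auto
    have eq: "x i = \<ominus> e i" if "x \<in> vecs I" "M(j := x) \<in> ?E" "i \<in> I" for x i
    proof -
      have col: "(\<lambda>k\<in>J. (M(j := x)) k i) \<in> vecs J"
        using vecs_in [OF Mv] vecs_in [OF that(1)] that(3) by auto
      have "\<zero> = a j \<otimes> x i \<oplus> dot ?J a (\<lambda>k\<in>J. (M(j := x)) k i)"
        using dot_remove [OF J j a(1) col] that j by simp
      also have "dot ?J a (\<lambda>k\<in>J. (M(j := x)) k i) = e i"
        unfolding e_def dot_def using vecs_in [OF Mv] vecs_in [OF a(1)] that(3)
        by (intro finsum_cong') auto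
      finally show ?thesis
        using e [OF that(3)] vecs_in [OF that(1,3)] by (simp add: a minus_equality)
    qed
    have "\<exists>w. {x \<in> vecs I. M(j := x) \<in> ?E} \<subseteq> {w}"
    proof (cases "\<exists>w. w \<in> vecs I \<and> M(j := w) \<in> ?E")
      case True
      then obtain w where w: "w \<in> vecs I" "M(j := w) \<in> ?E" by blast
      have "x = w" if "x \<in> vecs I" "M(j := x) \<in> ?E" for x
        using eq [OF that] eq [OF w] by (intro vec_eqI [OF that(1) w(1)]) simp
      thus ?thesis by blast
    qed blast
    then obtain w where w: "{x \<in> vecs I. M(j := x) \<in> ?E} \<subseteq> {w}" by blast
    have "measure_pmf.prob (\<mu> j) {x. M(j := x) \<in> ?E} = measure_pmf.prob (\<mu> j) {x \<in> vecs I. M(j := x) \<in> ?E}"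
      using supp [OF j] by (intro measure_prob_cong_0) (auto simp: set_pmf_iff)
    also have "\<dots> \<le> measure_pmf.prob (\<mu> j) {w}"
      using w by (intro measure_pmf.finite_measure_mono) auto
    also have "\<dots> \<le> \<beta>" using \<beta> by (simp add: measure_pmf_single)
    finally show ?thesis .
  qed
  have "measure_pmf.prob (Pi_pmf J d \<mu>) ?E =
      measure_pmf.expectation (Pi_pmf ?J d \<mu>) (\<lambda>M. measure_pmf.prob (\<mu> j) {x. M(j := x) \<in> ?E})"
    using prob_Pi_pmf_insert(2) [of ?J j d \<mu> ?E] J unfolding Jeq [symmetric] by blast
  also have "\<dots> \<le> \<beta>"
    by (intro measure_pmf.integral_le_const integrable_prob_pmf) (use bound in \<open>simp add: AE_measure_pmf_iff\<close>)
  finally show ?thesis .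
qed

text \<open>
  A nontrivial relation can be scaled so that some coefficient is \<open>1\<close>. The union bound over these
  normalised relations saves the factor \<open>q\<close> that is needed when all \<open>n\<close> columns are treated at once.
\<close>

lemma prob_columns_dependent_le:
  assumes J: "finite J" and supp: "\<And>j. j \<in> J \<Longrightarrow> set_pmf (\<mu> j) \<subseteq> vecs I"
    and \<beta>: "\<And>j w. j \<in> J \<Longrightarrow> pmf (\<mu> j) w \<le> \<beta>"
  shows "measure_pmf.prob (Pi_pmf J d \<mu>)
      {M. \<exists>a\<in>vecs J. a \<noteq> zero_vec J \<and> (\<forall>i\<in>I. dot J a (\<lambda>j\<in>J. M j i) = \<zero>)} \<le>
    real (card J) * real q ^ (card J - 1) * \<beta>"
proof -
  let ?P = "measure_pmf.prob (Pi_pmf J d \<mu>)"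
  define E where "E a = {M. \<forall>i\<in>I. dot J a (\<lambda>j\<in>J. M j i) = \<zero>}" for a
  define N where "N j = {a \<in> vecs J. a j = \<one>}" for j
  define D where "D = {M. \<exists>a\<in>vecs J. a \<noteq> zero_vec J \<and> (\<forall>i\<in>I. dot J a (\<lambda>j\<in>J. M j i) = \<zero>)}"
  have finN: "finite (N j)" for j using J by (simp add: N_def)
  have cN: "card (N j) \<le> q ^ (card J - 1)" if j: "j \<in> J" for j
  proof -
    have "inj_on (\<lambda>a. restrict a (J - {j})) (N j)"
    proof (rule inj_onI)
      fix a b assume ab: "a \<in> N j" "b \<in> N j" "restrict a (J - {j}) = restrict b (J - {j})"
      show "a = b"
      proof (rule vec_eqI [of _ J])
        fix k assume "k \<in> J"
        moreover have "restrict a (J - {j}) k = restrict b (J - {j}) k" by (simp only: ab(3))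
        ultimately show "a k = b k" using ab(1,2) by (cases "k = j") (simp_all add: N_def)
      qed (use ab in \<open>auto simp: N_def\<close>)
    qed
    moreover have "(\<lambda>a. restrict a (J - {j})) ` N j \<subseteq> vecs (J - {j})"
      unfolding N_def using vecs_in by (intro image_subsetI restrict_PiE) auto
    ultimately have "card (N j) \<le> card (vecs (J - {j}))"
      using J by (intro card_inj_on_le) auto
    thus ?thesis using J j by (simp add: card_vec)
  qed
  have cover: "M \<in> (\<Union>j\<in>J. \<Union>a\<in>N j. E a)" if M: "M \<in> set_pmf (Pi_pmf J d \<mu>)" "M \<in> D" for M
  proof -
    have Mv: "M k \<in> vecs I" if "k \<in> J" for k using set_Pi_pmf_columns [OF J supp M(1) that] .
    obtain a where a: "a \<in> vecs J" "a \<noteq> zero_vec J" "\<And>i. i \<in> I \<Longrightarrow> dot J a (\<lambda>j\<in>J. M j i) = \<zero>"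
      using M(2) by (auto simp: D_def)
    obtain j where j: "j \<in> J" "a j \<noteq> \<zero>"
      using a vec_eqI [OF a(1) zero_vec_in_vec] by (auto simp: zero_vec_def)
    have u: "a j \<in> Units K" using j vecs_in [OF a(1) j(1)] by (simp add: field_Units)
    let ?b = "axpy J (zero_vec J) (inv (a j)) a"
    have "?b \<in> N j"
      using u j a vecs_in [OF a(1) j(1)] by (simp add: N_def) (simp add: axpy_def zero_vec_def)
    moreover have "M \<in> E ?b"
      unfolding E_def
    proof (intro CollectI ballI)
      fix i assume i: "i \<in> I"
      have col: "(\<lambda>k\<in>J. M k i) \<in> vecs J" using vecs_in [OF Mv] i by auto
      show "dot J ?b (\<lambda>j\<in>J. M j i) = \<zero>"
        using dot_axpy_left [OF J zero_vec_in_vec a(1) col, of "inv (a j)"] col a(3) [OF i] u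
        by simp
    qed
    ultimately show ?thesis using j by blast
  qed
  have "?P D = ?P (D \<inter> set_pmf (Pi_pmf J d \<mu>))"
    by (rule measure_Int_set_pmf [symmetric])
  also have "\<dots> \<le> ?P (\<Union>j\<in>J. \<Union>a\<in>N j. E a)"
    by (intro measure_pmf.finite_measure_mono) (use cover in auto)
  also have "\<dots> \<le> (\<Sum>j\<in>J. ?P (\<Union>a\<in>N j. E a))"
    by (intro measure_pmf.finite_measure_subadditive_finite J) auto
  also have "\<dots> \<le> (\<Sum>j\<in>J. \<Sum>a\<in>N j. ?P (E a))"
    by (intro sum_mono measure_pmf.finite_measure_subadditive_finite finN) auto
  also have "\<dots> \<le> (\<Sum>j\<in>J. \<Sum>a\<in>N j. \<beta>)"
    unfolding E_def N_def by (intro sum_mono prob_fixed_relation_le [OF J _ _ _ supp] \<beta>) auto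
  also have "\<dots> \<le> (\<Sum>j\<in>J. real (q ^ (card J - 1)) * \<beta>)"
  proof (intro sum_mono)
    fix j assume j: "j \<in> J"
    have "0 \<le> \<beta>" using \<beta> [OF j] pmf_nonneg order_trans by metis
    thus "(\<Sum>a\<in>N j. \<beta>) \<le> real (q ^ (card J - 1)) * \<beta>"
      using cN [OF j] by (simp only: sum_constant) (intro mult_right_mono, simp_all only: of_nat_le_iff)
  qed
  finally show ?thesis by (simp add: D_def mult.assoc)
qed

lemma prob_annihilates_some_le:
  assumes J: "finite J" and B: "finite B"
  shows "measure_pmf.prob (Pi_pmf J d \<mu>) {M. \<exists>v\<in>B. \<forall>j\<in>J. dot I v (M j) = \<zero>} \<le>
    (\<Sum>v\<in>B. \<Prod>j\<in>J. measure_pmf.prob (\<mu> j) {x. dot I v x = \<zero>})"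
proof -
  have "{M. \<exists>v\<in>B. \<forall>j\<in>J. dot I v (M j) = \<zero>} = (\<Union>v\<in>B. Pi J (\<lambda>_. {x. dot I v x = \<zero>}))"
    by (auto simp: Pi_def)
  hence "measure_pmf.prob (Pi_pmf J d \<mu>) {M. \<exists>v\<in>B. \<forall>j\<in>J. dot I v (M j) = \<zero>} \<le>
      (\<Sum>v\<in>B. measure_pmf.prob (Pi_pmf J d \<mu>) (Pi J (\<lambda>_. {x. dot I v x = \<zero>})))"
    using B by (simp only:) (intro measure_pmf.finite_measure_subadditive_finite, auto)
  thus ?thesis by (simp only: measure_Pi_pmf_Pi [OF J])
qed

text \<open>
  Coupling with the chain, by induction on the set of columns that remain. One column turns \<open>U\<close> into a
  subspace of the same or of \<open>1/q\<close> times the size, with the probabilities of the chain up to \<open>2\<epsilon>\<close>. The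
  hypothesis on the vectors of \<open>U\<close> is inherited by subspaces, which is why it is assumed for all columns at
  once.
\<close>

lemma left_kernel_follows_chain:
  fixes \<epsilon> :: real
  assumes I: "finite I" and J: "finite J" and supp: "\<And>j. j \<in> J \<Longrightarrow> set_pmf (\<mu> j) \<subseteq> vecs I"
    and U: "lin_closed I U" "card U = q ^ d" and \<epsilon>: "\<epsilon> \<ge> 0"
    and good: "\<And>j u. j \<in> J \<Longrightarrow> u \<in> U \<Longrightarrow> u \<noteq> zero_vec I \<Longrightarrow>
      \<bar>measure_pmf.prob (\<mu> j) {x. dot I u x = \<zero>} - 1 / q\<bar> \<le> \<epsilon>"
  shows "\<bar>measure_pmf.prob (Pi_pmf J dflt \<mu>) {M. \<exists>k\<in>A. card (annihilated I U J M) = q ^ k} -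
      measure_pmf.prob (corank_chain (1 / q) (card J) d) A\<bar> \<le> card J * (2 * \<epsilon>)"
  using J supp U good
proof (induction J arbitrary: U d rule: finite_induct)
  case empty
  have "q ^ d = q ^ k \<longleftrightarrow> d = k" for k using q_ge_2 by (intro power_inject_exp) simp
  thus ?case using empty by (simp add: annihilated_def measure_return indicator_def)
next
  case (insert j J)
  define G where "G e = measure_pmf.prob (corank_chain (1 / q) (card J) e) A" for e
  define f where "f x = measure_pmf.prob (Pi_pmf J dflt \<mu>)
      {M. M(j := x) \<in> {M. \<exists>k\<in>A. card (annihilated I U (insert j J) M) = q ^ k}}" for x
  \<comment> \<open>The columns that leave \<open>U\<close> unchanged; on them \<open>g\<close> is the chain started at \<open>d\<close>, elsewhere at \<open>d - 1\<close>.\<close>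
  define O' where "O' = {x. \<forall>u\<in>U. dot I u x = \<zero>}"
  define g where "g x = G (d - 1) + (G d - G (d - 1)) * indicator O' x" for x
  have q1: "q > 1" "real q > 1" using q_ge_2 by auto
  have G01: "0 \<le> G e" "G e \<le> 1" for e by (auto simp: G_def)
  have close: "\<bar>f x - g x\<bar> \<le> card J * (2 * \<epsilon>)" if x: "x \<in> set_pmf (\<mu> j)" for x
  proof -
    have xv: "x \<in> vecs I" using x insert.prems(1) by blast
    let ?U = "{u \<in> U. dot I u x = \<zero>}"
    have lin: "lin_closed I ?U"
      using lin_closed_annihilated [OF I insert.prems(2), of "{()}" "\<lambda>_. x"] xv
      by (simp add: annihilated_def)
    have "annihilated I U (insert j J) (M(j := x)) = annihilated I ?U J M" for M
      using insert.hyps by (auto simp: annihilated_def)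
    hence f: "f x = measure_pmf.prob (Pi_pmf J dflt \<mu>) {M. \<exists>k\<in>A. card (annihilated I ?U J M) = q ^ k}"
      by (simp add: f_def)
    have step: "\<bar>f x - G e\<bar> \<le> card J * (2 * \<epsilon>)" if "card ?U = q ^ e" for e
      unfolding f G_def
      by (rule insert.IH [OF _ lin that]) (use insert.prems in auto)
    show ?thesis
    proof (cases "x \<in> O'")
      case True
      hence "?U = U" by (auto simp: O'_def)
      hence "card ?U = q ^ d" using insert.prems(3) by simp
      thus ?thesis using step True by (simp add: g_def)
    next
      case False
      then obtain w where w: "w \<in> U" "dot I w x \<noteq> \<zero>" by (auto simp: O'_def)
      have "q ^ d = q * card ?U"
        using card_hyperplane [OF I insert.prems(2) xv w] insert.prems(3) by simp
      moreover have "d \<noteq> 0"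
      proof
        assume "d = 0"
        hence "q * card ?U = 1" using calculation by simp
        hence "q = 1" by (simp only: nat_mult_eq_1_iff)
        thus False using q1 by linarith
      qed
      ultimately have "q * q ^ (d - 1) = q * card ?U"
        by (metis power_eq_if)
      hence "card ?U = q ^ (d - 1)" using q1 by simp
      thus ?thesis using step False by (simp add: g_def)
    qed
  qed
  have intg: "integrable (measure_pmf (\<mu> j)) g" unfolding g_def by simp
  have intf: "integrable (measure_pmf (\<mu> j)) f" unfolding f_def by (rule integrable_prob_pmf)
  have "measure_pmf.prob (Pi_pmf (insert j J) dflt \<mu>)
      {M. \<exists>k\<in>A. card (annihilated I U (insert j J) M) = q ^ k} = measure_pmf.expectation (\<mu> j) f"
    unfolding f_def by (rule prob_Pi_pmf_insert(1) [OF insert.hyps(1,2)])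
  moreover have "\<bar>measure_pmf.expectation (\<mu> j) f - measure_pmf.expectation (\<mu> j) g\<bar> \<le> card J * (2 * \<epsilon>)"
    by (rule expectation_close [OF intf intg close])
  moreover have "measure_pmf.expectation (\<mu> j) g =
      G (d - 1) + (G d - G (d - 1)) * measure_pmf.prob (\<mu> j) O'"
    unfolding g_def by simp
  moreover have "measure_pmf.prob (corank_chain (1 / q) (card (insert j J)) d) A =
      G (d - 1) + (G d - G (d - 1)) * (1 / q ^ d)"
    using insert.hyps q1 prob_corank_chain_Suc [of "1 / real q" "card J" d A]
    by (simp add: G_def power_divide algebra_simps)
  moreover have "\<bar>(G d - G (d - 1)) * measure_pmf.prob (\<mu> j) O' - (G d - G (d - 1)) * (1 / q ^ d)\<bar> \<le> 2 * \<epsilon>"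
  proof -
    have "\<bar>measure_pmf.prob (\<mu> j) O' - 1 / q ^ d\<bar> \<le> 2 * \<epsilon>"
      using prob_orthogonal_to_subspace [OF I, of "\<mu> j" U \<epsilon>] insert.prems \<epsilon> by (simp add: O'_def)
    moreover have "\<bar>G d - G (d - 1)\<bar> \<le> 1" using G01 [of d] G01 [of "d - 1"] by linarith
    ultimately have "\<bar>G d - G (d - 1)\<bar> * \<bar>measure_pmf.prob (\<mu> j) O' - 1 / q ^ d\<bar> \<le> 1 * (2 * \<epsilon>)"
      by (intro mult_mono) auto
    thus ?thesis by (simp only: right_diff_distrib [symmetric] abs_mult mult_1_left)
  qed
  moreover have "real (card (insert j J)) * (2 * \<epsilon>) = card J * (2 * \<epsilon>) + 2 * \<epsilon>"
    using insert.hyps by (simp add: algebra_simps)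
  ultimately show ?case by linarith
qed

text \<open>
  The set \<open>B\<close> collects the vectors that must not be orthogonal to the first \<open>k\<close> columns. Unless one of them
  is, or these columns are dependent, the left kernel has size \<open>q\<^bsup>n-k\<^esup>\<close> and consists of unbiased vectors,
  and the remaining columns follow the chain. The first two summands bound the two exceptional
  probabilities.
\<close>

lemma corank_law_vs_chain:
  fixes n k :: nat and \<epsilon> :: real
  defines "I \<equiv> {1..n}"
  assumes k: "k \<le> n"
    and supp: "\<And>j. j \<in> I \<Longrightarrow> set_pmf (\<mu> j) \<subseteq> vecs I"
    and \<beta>: "\<And>j w. j \<in> I \<Longrightarrow> pmf (\<mu> j) w \<le> \<beta>"
    and \<epsilon>: "\<epsilon> \<ge> 0"
    and B: "finite B"
    and bad: "\<And>j v. j \<in> {k<..n} \<Longrightarrow> v \<in> vecs I \<Longrightarrow> v \<noteq> zero_vec I \<Longrightarrow> v \<notin> B \<Longrightarrow>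
      \<bar>measure_pmf.prob (\<mu> j) {x. dot I v x = \<zero>} - 1 / q\<bar> \<le> \<epsilon>"
  shows "\<bar>measure_pmf.prob (map_pmf (corank K n) (Pi_pmf I undefined \<mu>)) A -
      measure_pmf.prob (corank_chain (1 / q) (n - k) (n - k)) A\<bar> \<le>
    real k * real q ^ (k - 1) * \<beta> +
    (\<Sum>v\<in>B. \<Prod>j\<in>{1..k}. measure_pmf.prob (\<mu> j) {x. dot I v x = \<zero>}) +
    real (n - k) * (2 * \<epsilon>)"
proof -
  let ?J = "{1..k}" and ?J' = "{k<..n}"
  have I [simp]: "finite I" by (simp add: I_def)
  have Ieq: "I = ?J \<union> ?J'" using k by (auto simp: I_def)
  have JI: "?J \<subseteq> I" and J'I: "?J' \<subseteq> I" using Ieq by auto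
  define c where "c = measure_pmf.prob (corank_chain (1 / q) (n - k) (n - k)) A"
  define X where "X = {M. corank K n M \<in> A}"
  define f where "f M = measure_pmf.prob (Pi_pmf ?J' undefined \<mu>)
      {M'. (\<lambda>j. if j \<in> ?J then M j else M' j) \<in> X}" for M
  \<comment> \<open>The exceptional events: dependent columns, and a forbidden vector in the left kernel.\<close>
  define D1 where "D1 = {M. \<exists>a\<in>vecs ?J. a \<noteq> zero_vec ?J \<and> (\<forall>i\<in>I. dot ?J a (\<lambda>j\<in>?J. M j i) = \<zero>)}"
  define D2 where "D2 = {M. \<exists>v\<in>B. \<forall>j\<in>?J. dot I v (M j) = \<zero>}"
  let ?P = "Pi_pmf ?J undefined \<mu>"
  have suppJ: "set_pmf (\<mu> j) \<subseteq> vecs I" if "j \<in> ?J \<union> ?J'" for j using supp that Ieq by auto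
  have q1: "q > 1" "real q > 1" using q_ge_2 by auto
  have close: "\<bar>f M - c\<bar> \<le> (n - k) * (2 * \<epsilon>) + indicator (D1 \<union> D2) M" if M: "M \<in> set_pmf ?P" for M
  proof (cases "M \<in> D1 \<union> D2")
    case True
    have "\<bar>f M - c\<bar> \<le> 1"
      unfolding f_def c_def abs_le_iff by (auto simp: diff_le_eq intro: add_increasing2)
    moreover have "0 \<le> (n - k) * (2 * \<epsilon>)" using \<epsilon> by simp
    moreover have "indicator (D1 \<union> D2) M = (1 :: real)" using True by simp
    ultimately show ?thesis by linarith
  next
    case False
    have Mv: "M j \<in> vecs I" if "j \<in> ?J" for j
      using suppJ by (intro set_Pi_pmf_columns [OF _ _ M that]) auto
    define U where "U = annihilated I (vecs I) ?J M"
    have U: "lin_closed I U" unfolding U_def by (intro lin_closed_annihilated Mv) auto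
    have "annihilated ?J (vecs ?J) I (\<lambda>i. \<lambda>j\<in>?J. M j i) = {zero_vec ?J}"
    proof -
      have "dot ?J (zero_vec ?J) (\<lambda>j\<in>?J. M j i) = \<zero>" if "i \<in> I" for i
        using vecs_in [OF Mv that] by (intro dot_zero_vec_left) auto
      hence "zero_vec ?J \<in> annihilated ?J (vecs ?J) I (\<lambda>i. \<lambda>j\<in>?J. M j i)"
        unfolding annihilated_def mem_Collect_eq by (intro conjI ballI zero_vec_in_vec)
      moreover have "a = zero_vec ?J" if "a \<in> annihilated ?J (vecs ?J) I (\<lambda>i. \<lambda>j\<in>?J. M j i)" for a
      proof (rule ccontr)
        assume "a \<noteq> zero_vec ?J"
        hence "M \<in> D1" unfolding D1_def mem_Collect_eq
          using that \<open>a \<noteq> zero_vec ?J\<close> by (intro bexI [of _ a] conjI) (simp_all add: annihilated_def)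
        thus False using False by simp
      qed
      ultimately show ?thesis by (rule singleton_eqI)
    qed
    moreover have "q ^ card ?J * card U =
        q ^ card I * card (annihilated ?J (vecs ?J) I (\<lambda>i. \<lambda>j\<in>?J. M j i))"
      unfolding U_def by (rule card_left_right_kernel [OF I finite_atLeastAtMost Mv])
    ultimately have "q ^ k * card U = q ^ n" by (simp only: card_atLeastAtMost I_def) simp
    also have "\<dots> = q ^ k * q ^ (n - k)" using k by (simp flip: power_add)
    finally have cU: "card U = q ^ (n - k)" using q1 by simp
    have "M \<notin> D2" using False by simp
    hence goodU: "\<bar>measure_pmf.prob (\<mu> j) {x. dot I u x = \<zero>} - 1 / q\<bar> \<le> \<epsilon>"
      if "j \<in> ?J'" "u \<in> U" "u \<noteq> zero_vec I" for j u
      using that unfolding U_def D2_def annihilated_def mem_Collect_eq by (intro bad) blast+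
    have ev: "(\<lambda>j. if j \<in> ?J then M j else M' j) \<in> X \<longleftrightarrow> (\<exists>k\<in>A. card (annihilated I U ?J' M') = q ^ k)"
      if M': "M' \<in> set_pmf (Pi_pmf ?J' undefined \<mu>)" for M'
    proof -
      let ?M = "\<lambda>j. if j \<in> ?J then M j else M' j"
      have M'v: "M' j \<in> vecs I" if "j \<in> ?J'" for j
        using suppJ by (intro set_Pi_pmf_columns [OF _ _ M' that]) auto
      have "?M j \<in> vecs I" if "j \<in> I" for j using that Mv M'v Ieq by auto
      hence "q ^ corank K n ?M = card (annihilated I (vecs I) I ?M)"
        unfolding I_def by (intro power_corank_eq_card_left_kernel) simp
      also have "annihilated I (vecs I) I ?M = annihilated I U ?J' M'"
      proof -
        have "annihilated I (vecs I) I ?M = annihilated I (annihilated I (vecs I) ?J ?M) ?J' ?M"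
          using annihilated_Un [of I "vecs I" ?J ?J' ?M] unfolding Ieq [symmetric] .
        also have "annihilated I (vecs I) ?J ?M = U"
          unfolding U_def by (rule annihilated_cong) simp
        also have "annihilated I U ?J' ?M = annihilated I U ?J' M'"
          by (rule annihilated_cong) simp
        finally show ?thesis .
      qed
      finally show ?thesis
        unfolding X_def mem_Collect_eq using power_inject_exp [OF q1(1), of "corank K n ?M"]
        by (metis (no_types, lifting))
    qed
    have "f M = measure_pmf.prob (Pi_pmf ?J' undefined \<mu>) {M'. \<exists>k\<in>A. card (annihilated I U ?J' M') = q ^ k}"
      unfolding f_def by (intro measure_prob_cong_0) (use ev in \<open>auto simp: set_pmf_iff\<close>)
    moreover have "\<bar>measure_pmf.prob (Pi_pmf ?J' undefined \<mu>)
        {M'. \<exists>k\<in>A. card (annihilated I U ?J' M') = q ^ k} -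
        measure_pmf.prob (corank_chain (1 / q) (card ?J') (n - k)) A\<bar> \<le> card ?J' * (2 * \<epsilon>)"
      by (rule left_kernel_follows_chain [OF I finite_greaterThanAtMost _ U cU \<epsilon> goodU])
         (use suppJ in blast)
    ultimately have "\<bar>f M - c\<bar> \<le> (n - k) * (2 * \<epsilon>)"
      unfolding c_def by (simp only: card_greaterThanAtMost)
    moreover have "indicator (D1 \<union> D2) M = (0 :: real)" using False by simp
    ultimately show ?thesis by simp
  qed
  have "measure_pmf.prob (map_pmf (corank K n) (Pi_pmf I undefined \<mu>)) A =
      measure_pmf.prob (Pi_pmf (?J \<union> ?J') undefined \<mu>) X"
    by (simp add: X_def vimage_def Ieq)
  also have "\<dots> = measure_pmf.expectation ?P f"
    unfolding f_def by (rule prob_Pi_pmf_union) auto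
  finally have Ef: "measure_pmf.prob (map_pmf (corank K n) (Pi_pmf I undefined \<mu>)) A =
      measure_pmf.expectation ?P f" .
  have intf: "integrable (measure_pmf ?P) f" unfolding f_def by (rule integrable_prob_pmf)
  have "\<bar>measure_pmf.expectation ?P f - c\<bar> = \<bar>measure_pmf.expectation ?P (\<lambda>M. f M - c)\<bar>"
    using intf by simp
  also have "\<dots> \<le> measure_pmf.expectation ?P (\<lambda>M. \<bar>f M - c\<bar>)" by (rule integral_abs_bound)
  also have "\<dots> \<le> measure_pmf.expectation ?P (\<lambda>M. (n - k) * (2 * \<epsilon>) + indicator (D1 \<union> D2) M)"
    using intf close by (intro integral_mono_AE) (auto simp: AE_measure_pmf_iff)
  also have "\<dots> = (n - k) * (2 * \<epsilon>) + measure_pmf.prob ?P (D1 \<union> D2)" by simp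
  also have "measure_pmf.prob ?P (D1 \<union> D2) \<le> measure_pmf.prob ?P D1 + measure_pmf.prob ?P D2"
    by (rule measure_Un_le) auto
  also have "measure_pmf.prob ?P D1 \<le> real (card ?J) * real q ^ (card ?J - 1) * \<beta>"
    unfolding D1_def using suppJ \<beta> JI by (intro prob_columns_dependent_le) auto
  also have "measure_pmf.prob ?P D2 \<le> (\<Sum>v\<in>B. \<Prod>j\<in>?J. measure_pmf.prob (\<mu> j) {x. dot I v x = \<zero>})"
    unfolding D2_def by (rule prob_annihilates_some_le [OF _ B]) simp
  finally show ?thesis unfolding Ef c_def by simp
qed

end

section \<open>The error terms\<close>

context finite_field
begin

definition support :: "'i set \<Rightarrow> ('i \<Rightarrow> 'a) \<Rightarrow> 'i set" where
  "support I v = {i \<in> I. v i \<noteq> \<zero>}"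

text \<open>
  There are at most \<open>2\<^bsup>|I|\<^esup>\<close> supports \<open>S\<close>, and the vectors with support \<open>S\<close> embed into \<open>K\<^sup>S\<close>.
\<close>

lemma card_small_support_le:
  assumes I: "finite I" and t: "t \<ge> 0"
  shows "real (card {v \<in> vecs I. real (card (support I v)) < t}) \<le> 2 ^ card I * real q powr t"
proof -
  define T where "T = {S. S \<subseteq> I \<and> real (card S) < t}"
  define W where "W S = {v \<in> vecs I. support I v = S}" for S
  have finT: "finite T" and cT: "card T \<le> 2 ^ card I"
    using I card_mono [of "Pow I" T] finite_subset [of T "Pow I"] by (auto simp: T_def card_Pow)
  have q1: "real q \<ge> 1" using q_ge_2 by simp
  have cW: "real (card (W S)) \<le> real q powr t" if S: "S \<in> T" for S
  proof -
    have finS: "finite S" using S I finite_subset by (auto simp: T_def)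
    have inj: "inj_on (\<lambda>v. restrict v S) (W S)"
    proof (rule inj_onI)
      fix u v assume uv: "u \<in> W S" "v \<in> W S" "restrict u S = restrict v S"
      show "u = v"
      proof (rule vec_eqI [of _ I])
        fix i assume i: "i \<in> I"
        have "restrict u S i = restrict v S i" by (simp only: uv(3))
        thus "u i = v i" using uv(1,2) i by (cases "i \<in> S") (auto simp: W_def support_def)
      qed (use uv(1,2) in \<open>simp_all add: W_def\<close>)
    qed
    have "(\<lambda>v. restrict v S) ` W S \<subseteq> vecs S"
    proof (rule image_subsetI)
      fix v assume "v \<in> W S"
      hence "v i \<in> carrier K" if "i \<in> S" for i
        using that S vecs_in [of v I i] by (auto simp: W_def T_def)
      thus "restrict v S \<in> vecs S" by simp
    qed
    hence "card (W S) \<le> q ^ card S"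
      using card_inj_on_le [OF inj _ finite_vec [OF finS]] card_vec [OF finS] by simp
    hence "real (card (W S)) \<le> real (q ^ card S)" by (simp only: of_nat_le_iff)
    also have "\<dots> = real q powr card S" using q1 by (simp add: powr_realpow)
    also have "\<dots> \<le> real q powr t" using S q1 by (intro powr_mono) (simp_all add: T_def)
    finally show ?thesis .
  qed
  have "{v \<in> vecs I. real (card (support I v)) < t} = (\<Union>S\<in>T. W S)"
    by (auto simp: T_def W_def support_def)
  hence "card {v \<in> vecs I. real (card (support I v)) < t} \<le> (\<Sum>S\<in>T. card (W S))"
    using card_UN_le [OF finT] by (simp only:)
  hence "real (card {v \<in> vecs I. real (card (support I v)) < t}) \<le> real (\<Sum>S\<in>T. card (W S))"
    by (simp only: of_nat_le_iff)
  also have "\<dots> \<le> (\<Sum>S\<in>T. real q powr t)" unfolding of_nat_sum by (intro sum_mono cW)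
  also have "\<dots> = real (card T) * real q powr t" by simp
  also have "\<dots> \<le> 2 ^ card I * real q powr t"
    using cT by (intro mult_right_mono) (simp_all flip: of_nat_le_iff)
  finally show ?thesis .
qed

lemma prod_prob_le:
  assumes G: "G \<subseteq> J" "finite J" and b: "\<And>j. j \<in> G \<Longrightarrow> measure_pmf.prob (\<mu> j) (E j) \<le> b"
  shows "(\<Prod>j\<in>J. measure_pmf.prob (\<mu> j) (E j)) \<le> b ^ card G"
proof -
  have "(\<Prod>j\<in>J. measure_pmf.prob (\<mu> j) (E j)) =
      (\<Prod>j\<in>J - G. measure_pmf.prob (\<mu> j) (E j)) * (\<Prod>j\<in>G. measure_pmf.prob (\<mu> j) (E j))"
    using G by (rule prod.subset_diff)
  also have "\<dots> \<le> 1 * (\<Prod>j\<in>G. b)"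
    by (intro mult_mono prod_le_1 prod_mono prod_nonneg) (auto simp: b)
  finally show ?thesis by simp
qed

end

text \<open>
  The hypotheses of the theorem for fixed \<open>K\<close> and \<open>n\<close>, restricted to \<open>q \<ge> C\<close>, where \<open>C/q\<close> is a useful
  probability bound.
\<close>

locale near_uniform_columns = finite_field K for K :: "('a, 'b) ring_scheme" (structure) +
  fixes n :: nat and F :: "nat \<Rightarrow> nat set" and \<mu> :: "nat \<Rightarrow> (nat \<Rightarrow> 'a) pmf" and \<alpha> C :: real
  assumes n: "1 \<le> n" and \<alpha>: "0 < \<alpha>" "\<alpha> \<le> 1 / 20" and C: "1 \<le> C"
    and F_subset: "\<And>j. j \<in> {1..n} \<Longrightarrow> F j \<subseteq> {1..n}"
    and F_col: "\<And>j. j \<in> {1..n} \<Longrightarrow> real (card (F j)) < \<alpha> * real n"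
    and F_row: "\<And>i. i \<in> {1..n} \<Longrightarrow> real (card {j \<in> {1..n}. i \<in> F j}) \<le> (1 - 12 * \<alpha>) * real n"
    and columns: "\<And>j. j \<in> {1..n} \<Longrightarrow> near_uniform_vector K C n (F j) (\<mu> j)"
    and C_le_q: "C \<le> real q"
begin

abbreviation "I \<equiv> {1..n}"

lemma q_pos: "real q > 0" and q_ge1: "real q \<ge> 1" and q_ge2: "real q \<ge> 2"
  using q_ge_2 by simp_all

lemma C_over_q: "0 < C / q" "C / q \<le> 1"
  using C C_le_q q_pos by simp_all

lemma set_pmf_column: "j \<in> I \<Longrightarrow> set_pmf (\<mu> j) \<subseteq> vecs I"
  using near_uniform_vectorD(1) [OF columns] .

lemma power_le_powr:
  assumes "t \<le> real m"
  shows "(C / q) ^ m \<le> (C / q) powr t"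
proof -
  have "(C / q) ^ m = (C / q) powr (real m)" using C_over_q by (simp add: powr_realpow)
  also have "\<dots> \<le> (C / q) powr t" using C_over_q assms by (intro powr_mono') auto
  finally show ?thesis .
qed

lemma powr_C_over_q_le:
  assumes "t \<le> real m"
  shows "(C / q) powr t \<le> C ^ m * real q powr (- t)"
proof -
  have "(C / q) powr t = C powr t * real q powr (- t)"
    using C q_pos by (simp add: powr_divide powr_minus_divide)
  also have "C powr t \<le> C powr (real m)" using C assms by (intro powr_mono) auto
  also have "C powr (real m) = C ^ m" using C by (simp add: powr_realpow)
  finally show ?thesis by (simp add: mult_right_mono)
qed

lemma pmf_column_le:
  assumes "j \<in> I"
  shows "pmf (\<mu> j) w \<le> (C / q) powr ((1 - \<alpha>) * n)"
proof -
  have "card (I - F j) = n - card (F j)" "card (F j) \<le> n"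
    using F_subset [OF assms] card_mono [of I "F j"] by (simp_all add: card_Diff_subset finite_subset)
  hence "(1 - \<alpha>) * n \<le> real (card (I - F j))"
    using F_col [OF assms] by (simp add: of_nat_diff left_diff_distrib)
  from power_le_powr [OF this] show ?thesis
    using pmf_near_uniform_vector_le [OF columns [OF assms], of w] by linarith
qed

lemma prob_column_orthogonal_le:
  assumes "j \<in> I" "v \<in> vecs I" "i \<in> support I v" "i \<notin> F j"
  shows "measure_pmf.prob (\<mu> j) {x. dot I v x = \<zero>} \<le> C / q"
  using assms columns F_subset by (intro prob_dot_eq_0_le [of _ _ "F j" _ _ i]) (auto simp: support_def)

text \<open>
  Take \<open>i\<close> in the support of \<open>v\<close>. By the row hypothesis at least \<open>12\<alpha>n\<close> columns have a near uniform
  \<open>i\<close>-th entry, and at least \<open>12\<alpha>n - (n - k)\<close> of these are among the first \<open>k\<close>. This gain beats the number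
  of vectors, which is about \<open>q\<^bsup>\<alpha>n\<^esup>\<close>.
\<close>

lemma small_support_sum_le:
  assumes k: "k \<le> n" and t: "real (n - k) \<le> 12 * \<alpha> * n"
  defines "B \<equiv> {v \<in> vecs I. real (card (support I v)) < \<alpha> * n} - {zero_vec I}"
  shows "(\<Sum>v\<in>B. \<Prod>j\<in>{1..k}. measure_pmf.prob (\<mu> j) {x. dot I v x = \<zero>}) \<le>
    2 ^ n * C ^ n * real q powr (real (n - k) - 11 * \<alpha> * n)"
proof -
  let ?t = "12 * \<alpha> * n - real (n - k)"
  have each: "(\<Prod>j\<in>{1..k}. measure_pmf.prob (\<mu> j) {x. dot I v x = \<zero>}) \<le> (C / q) powr ?t"
    if v: "v \<in> B" for v
  proof -
    have vv: "v \<in> vecs I" "v \<noteq> zero_vec I" using v by (auto simp: B_def)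
    then obtain i where i: "i \<in> support I v"
      using vec_eqI [OF vv(1) zero_vec_in_vec] by (auto simp: support_def zero_vec_def)
    hence iI: "i \<in> I" by (simp add: support_def)
    define G where "G = {j \<in> {1..k}. i \<notin> F j}"
    have "I = {j \<in> I. i \<in> F j} \<union> (G \<union> {k<..n})" unfolding G_def using k by auto
    hence "n \<le> card ({j \<in> I. i \<in> F j} \<union> (G \<union> {k<..n}))" by (metis card_atLeastAtMost diff_Suc_1 order_refl)
    also have "\<dots> \<le> card {j \<in> I. i \<in> F j} + (card G + card {k<..n})"
      by (intro order_trans [OF card_Un_le] add_left_mono card_Un_le)
    finally have "real n \<le> real (card {j \<in> I. i \<in> F j} + (card G + (n - k)))"
      by (simp only: of_nat_le_iff card_greaterThanAtMost)
    hence "?t \<le> real (card G)" using F_row [OF iI] by (simp add: algebra_simps)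
    hence "(C / q) ^ card G \<le> (C / q) powr ?t" by (rule power_le_powr)
    moreover have "(\<Prod>j\<in>{1..k}. measure_pmf.prob (\<mu> j) {x. dot I v x = \<zero>}) \<le> (C / q) ^ card G"
    proof (rule prod_prob_le)
      fix j assume "j \<in> G"
      hence "j \<in> I" "i \<notin> F j" using k by (auto simp: G_def)
      thus "measure_pmf.prob (\<mu> j) {x. dot I v x = \<zero>} \<le> C / q"
        by (rule prob_column_orthogonal_le [OF _ vv(1) i])
    qed (auto simp: G_def)
    ultimately show ?thesis by linarith
  qed
  have "\<alpha> * n \<le> 1 / 20 * n" using \<alpha> by (intro mult_right_mono) auto
  hence tn: "?t \<le> real n" by simp
  have "card B \<le> card {v \<in> vecs I. real (card (support I v)) < \<alpha> * n}"
    unfolding B_def by (intro card_mono) auto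
  hence cB: "real (card B) \<le> 2 ^ n * real q powr (\<alpha> * n)"
    using card_small_support_le [of I "\<alpha> * n"] \<alpha> by simp
  have "(\<Sum>v\<in>B. \<Prod>j\<in>{1..k}. measure_pmf.prob (\<mu> j) {x. dot I v x = \<zero>}) \<le> (\<Sum>v\<in>B. (C / q) powr ?t)"
    by (intro sum_mono each)
  also have "\<dots> = real (card B) * (C / q) powr ?t" by simp
  also have "\<dots> \<le> (2 ^ n * real q powr (\<alpha> * n)) * (C ^ n * real q powr (- ?t))"
    by (intro mult_mono cB powr_C_over_q_le tn) auto
  also have "\<dots> = 2 ^ n * C ^ n * real q powr (\<alpha> * n + - ?t)"
    unfolding powr_add by (simp only: mult_ac)
  finally show ?thesis by (simp add: algebra_simps)
qed

text \<open>
  A support of size at least \<open>\<alpha>n\<close> is not contained in any \<open>F\<^sub>j\<close>, so each of the first \<open>k\<close> columns contributes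
  a factor \<open>C/q\<close>. The number of biased vectors is bounded by \<open>card_biased_le\<close> for each of the remaining
  columns.
\<close>

lemma biased_sum_le:
  assumes k: "k \<le> n" and \<epsilon>: "\<epsilon> > 0"
  defines "B \<equiv> {v \<in> vecs I. \<alpha> * n \<le> real (card (support I v)) \<and>
    (\<exists>j\<in>{k<..n}. \<epsilon> < \<bar>measure_pmf.prob (\<mu> j) {x. dot I v x = \<zero>} - 1 / q\<bar>)}"
  shows "(\<Sum>v\<in>B. \<Prod>j\<in>{1..k}. measure_pmf.prob (\<mu> j) {x. dot I v x = \<zero>}) \<le>
    real n * (real q ^ n * ((real q + 1) * (C / q) powr ((1 - \<alpha>) * n)) / \<epsilon>\<^sup>2) * (C / q) ^ k"
proof -
  let ?b = "real q ^ n * ((real q + 1) * (C / q) powr ((1 - \<alpha>) * n)) / \<epsilon>\<^sup>2"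
  define W where "W j = {v \<in> vecs I. \<epsilon> < \<bar>measure_pmf.prob (\<mu> j) {x. dot I v x = \<zero>} - 1 / q\<bar>}" for j
  have b0: "?b \<ge> 0" by simp
  have each: "(\<Prod>j\<in>{1..k}. measure_pmf.prob (\<mu> j) {x. dot I v x = \<zero>}) \<le> (C / q) ^ k" if v: "v \<in> B" for v
  proof -
    have "measure_pmf.prob (\<mu> j) {x. dot I v x = \<zero>} \<le> C / q" if j: "j \<in> {1..k}" for j
    proof -
      have jI: "j \<in> I" using j k by auto
      have "real (card (F j)) < real (card (support I v))" using F_col [OF jI] v by (simp add: B_def)
      hence "\<not> support I v \<subseteq> F j"
        using card_mono [of "F j" "support I v"] finite_subset [OF F_subset [OF jI]] by auto
      then obtain i where "i \<in> support I v" "i \<notin> F j" by auto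
      thus ?thesis using prob_column_orthogonal_le [OF jI, of v i] v by (simp add: B_def)
    qed
    hence "(\<Prod>j\<in>{1..k}. measure_pmf.prob (\<mu> j) {x. dot I v x = \<zero>}) \<le> (C / q) ^ card {1..k}"
      by (intro prod_prob_le) auto
    thus ?thesis by simp
  qed
  have cW: "real (card (W j)) \<le> ?b" if "j \<in> {k<..n}" for j
    using card_biased_le [of I "\<mu> j" "(C / q) powr ((1 - \<alpha>) * n)" \<epsilon>] that set_pmf_column pmf_column_le \<epsilon>
    by (simp add: W_def)
  have "B \<subseteq> (\<Union>j\<in>{k<..n}. W j)" by (auto simp: B_def W_def)
  hence "card B \<le> card (\<Union>j\<in>{k<..n}. W j)" by (intro card_mono) (auto simp: W_def)
  also have "\<dots> \<le> (\<Sum>j\<in>{k<..n}. card (W j))" by (rule card_UN_le) simp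
  finally have "real (card B) \<le> real (\<Sum>j\<in>{k<..n}. card (W j))" by (simp only: of_nat_le_iff)
  also have "\<dots> \<le> (\<Sum>j\<in>{k<..n}. ?b)" unfolding of_nat_sum by (intro sum_mono cW)
  also have "\<dots> = real (n - k) * ?b" by simp
  also have "\<dots> \<le> real n * ?b" using b0 by (intro mult_right_mono) auto
  finally have cB: "real (card B) \<le> real n * ?b" .
  have "(\<Sum>v\<in>B. \<Prod>j\<in>{1..k}. measure_pmf.prob (\<mu> j) {x. dot I v x = \<zero>}) \<le> (\<Sum>v\<in>B. (C / q) ^ k)"
    by (intro sum_mono each)
  also have "\<dots> = real (card B) * (C / q) ^ k" by simp
  also have "\<dots> \<le> real n * ?b * (C / q) ^ k" using C_over_q by (intro mult_right_mono cB) auto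
  finally show ?thesis .
qed

abbreviation corank_prob :: "nat set \<Rightarrow> real" where
  "corank_prob \<equiv> measure_pmf.prob (map_pmf (corank K n) (Pi_pmf I undefined \<mu>))"

lemma n_le: "real n \<le> 2 ^ n" by (simp add: less_imp_le)

lemma collect_powers: "8 ^ n * (2 ^ n * C ^ (2 * n)) = (16 * C\<^sup>2) ^ n"
  unfolding power_mult power_mult_distrib [symmetric] by simp

lemma C_powers: "1 \<le> C ^ n" "C ^ n \<le> C ^ (2 * n)" "1 \<le> C ^ (2 * n)"
  using C by (auto intro: power_increasing one_le_power)

text \<open>
  All entries are near uniform, and \<open>q\<^bsup>-1\<^esup>\<close> is already small enough. The comparison is made with the chain
  of length \<open>0\<close>: the matrix is invertible and \<open>Q\<^sub>\<infinity> = 0\<close>, up to probability \<open>O(1/q)\<close>.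
\<close>

lemma corank_prob_close_small:
  assumes small: "\<alpha> * n < 1"
  shows "\<bar>corank_prob A - measure (Q_infinity q) A\<bar> \<le> (16 * C\<^sup>2) ^ n * real q powr (- (\<alpha> * n))"
proof -
  have F0: "F j = {}" if j: "j \<in> I" for j
  proof -
    have "real (card (F j)) < 1" using F_col [OF j] small by linarith
    hence "card (F j) = 0" by simp
    thus ?thesis using finite_subset [OF F_subset [OF j]] by simp
  qed
  have \<beta>: "pmf (\<mu> j) w \<le> (C / q) ^ n" if "j \<in> I" for j w
    using pmf_near_uniform_vector_le [OF columns [OF that], of w] F0 [OF that] by simp
  have "\<bar>corank_prob A - measure_pmf.prob (corank_chain (1 / q) (n - n) (n - n)) A\<bar> \<le>
      real n * real q ^ (n - 1) * (C / q) ^ n +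
      (\<Sum>v\<in>{}. \<Prod>j\<in>{1..n}. measure_pmf.prob (\<mu> j) {x. dot I v x = \<zero>}) + real (n - n) * (2 * 0)"
    by (rule corank_law_vs_chain [OF order_refl set_pmf_column \<beta>]) auto
  moreover have "real q ^ (n - 1) * (C / q) ^ n = C ^ n / q"
  proof -
    have e: "real q ^ n = real q ^ (n - 1) * q" using n power_minus_mult [of n "real q"] by simp
    show ?thesis using q_pos unfolding power_divide e by simp
  qed
  ultimately have 1: "\<bar>corank_prob A - measure_pmf.prob (corank_chain (1 / q) 0 0) A\<bar> \<le> real n * (C ^ n / q)"
    by (simp add: mult.assoc)
  have 2: "\<bar>measure_pmf.prob (corank_chain (1 / q) 0 0) A - measure (Q_infinity q) A\<bar> \<le> 2 * (1 / q)"
    using corank_chain_vs_Q_infinity [OF q_ge_2, of 0 A] by simp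
  have "\<bar>corank_prob A - measure (Q_infinity q) A\<bar> \<le> real n * (C ^ n / q) + 2 * (1 / q)"
    using 1 2 by linarith
  also have "\<dots> = (real n * C ^ n + 2) * real q powr (- 1)"
    using q_pos by (simp add: powr_minus field_simps)
  also have "\<dots> \<le> (16 * C\<^sup>2) ^ n * real q powr (- (\<alpha> * n))"
  proof (intro mult_mono)
    have "real n * C ^ n \<le> 2 ^ n * C ^ (2 * n)" using n_le C_powers C by (intro mult_mono) auto
    moreover have "2 * 1 \<le> 2 ^ n * C ^ (2 * n)"
      using n C_powers power_increasing [of 1 n "2 :: real"] by (intro mult_mono) auto
    ultimately have "real n * C ^ n + 2 \<le> 2 * (2 ^ n * C ^ (2 * n))" by linarith
    also have "\<dots> \<le> 8 ^ n * (2 ^ n * C ^ (2 * n))"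
      using n C power_increasing [of 1 n "8 :: real"] by (intro mult_right_mono) auto
    also have "\<dots> = (16 * C\<^sup>2) ^ n" by (rule collect_powers)
    finally show "real n * C ^ n + 2 \<le> (16 * C\<^sup>2) ^ n" .
    show "real q powr (- 1) \<le> real q powr (- (\<alpha> * n))"
      using small q_ge1 by (intro powr_mono) auto
  qed simp_all
  finally show ?thesis .
qed

text \<open>
  The exponents of \<open>q\<close> in the error terms are \<open>\<alpha>n - L\<close> for dependent columns, \<open>L - 11\<alpha>n\<close> for small supports,
  \<open>1 + \<alpha>n + L - n/2\<close> for biased vectors, \<open>-n/4\<close> for the coupling and \<open>-L\<close> for the chain. Because
  \<open>1 \<le> \<alpha>n \<le> n/20\<close>, all are at most \<open>-\<alpha>n\<close> when \<open>2\<alpha>n \<le> L \<le> 3\<alpha>n\<close>.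
\<close>

lemma corank_prob_close_large:
  assumes large: "1 \<le> \<alpha> * n"
  shows "\<bar>corank_prob A - measure (Q_infinity q) A\<bar> \<le> (16 * C\<^sup>2) ^ n * real q powr (- (\<alpha> * n))"
proof -
  define L where "L = nat \<lceil>2 * \<alpha> * n\<rceil>"
  define k where "k = n - L"
  define \<epsilon> where "\<epsilon> = real q powr (- (n / 4))"
  define \<beta> where "\<beta> = (C / q) powr ((1 - \<alpha>) * n)"
  define R where "R = real q powr (- (\<alpha> * n))"
  have an: "20 * (\<alpha> * n) \<le> n"
    using \<alpha> mult_right_mono [of "20 * \<alpha>" 1 "real n"] by simp
  have L: "2 * (\<alpha> * n) \<le> real L" "real L \<le> 3 * (\<alpha> * n)"
    using large \<alpha> unfolding L_def by linarith+
  have Ln: "L \<le> n" using L an by linarith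
  have k: "k \<le> n" "n - k = L" "real k = real n - real L" using Ln by (auto simp: k_def)
  have \<epsilon>0: "\<epsilon> > 0" using q_pos by (simp add: \<epsilon>_def)
  have R0: "R > 0" using q_pos by (simp add: R_def)
  have q_powr_le: "real q powr s \<le> R" if "s \<le> - (\<alpha> * n)" for s
    unfolding R_def using q_ge1 that by (intro powr_mono)
  have \<beta>_le: "\<beta> \<le> C ^ n * real q powr (- ((1 - \<alpha>) * n))"
    unfolding \<beta>_def using \<alpha> by (intro powr_C_over_q_le) (simp add: mult_left_le_one_le algebra_simps)
  have qk: "real q ^ k = real q powr (real n - real L)"
    using q_pos k(3) by (simp flip: powr_realpow)
  let ?pr = "\<lambda>v. \<Prod>j\<in>{1..k}. measure_pmf.prob (\<mu> j) {x. dot I v x = \<zero>}"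
  define B1 where "B1 = {v \<in> vecs I. real (card (support I v)) < \<alpha> * n} - {zero_vec I}"
  define B2 where "B2 = {v \<in> vecs I. \<alpha> * n \<le> real (card (support I v)) \<and>
    (\<exists>j\<in>{k<..n}. \<epsilon> < \<bar>measure_pmf.prob (\<mu> j) {x. dot I v x = \<zero>} - 1 / q\<bar>)}"
  have finB: "finite B1" "finite B2" by (auto simp: B1_def B2_def)
  have main: "\<bar>corank_prob A - measure_pmf.prob (corank_chain (1 / q) (n - k) (n - k)) A\<bar> \<le>
      real k * real q ^ (k - 1) * \<beta> + (\<Sum>v\<in>B1 \<union> B2. ?pr v) + real (n - k) * (2 * \<epsilon>)"
  proof (rule corank_law_vs_chain [OF k(1) set_pmf_column _ less_imp_le [OF \<epsilon>0]])
    show "pmf (\<mu> j) w \<le> \<beta>" if "j \<in> I" for j w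
      unfolding \<beta>_def by (rule pmf_column_le [OF that])
    show "\<bar>measure_pmf.prob (\<mu> j) {x. dot I v x = \<zero>} - 1 / q\<bar> \<le> \<epsilon>"
      if "j \<in> {k<..n}" "v \<in> vecs I" "v \<noteq> zero_vec I" "v \<notin> B1 \<union> B2" for j v
    proof (rule ccontr)
      assume *: "\<not> ?thesis"
      show False
      proof (cases "real (card (support I v)) < \<alpha> * n")
        case True
        hence "v \<in> B1" using that(2,3) by (simp only: B1_def) blast
        thus False using that(4) by blast
      next
        case False
        hence "v \<in> B2" using that(1,2) * unfolding B2_def not_le not_less by blast
        thus False using that(4) by blast
      qed
    qed
  qed (use finB in simp_all)
  have t1: "real k * real q ^ (k - 1) * \<beta> \<le> 2 ^ n * C ^ (2 * n) * R"
  proof -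
    have "real k \<le> 2 ^ n" using n_le k(1) by linarith
    hence "real k * real q ^ (k - 1) \<le> 2 ^ n * real q ^ k"
      using q_ge1 by (intro mult_mono power_increasing) auto
    hence "real k * real q ^ (k - 1) * \<beta> \<le> (2 ^ n * real q ^ k) * (C ^ n * real q powr (- ((1 - \<alpha>) * n)))"
      using \<beta>_le by (rule mult_mono) (simp_all add: \<beta>_def)
    also have "\<dots> = 2 ^ n * C ^ n * real q powr ((real n - real L) + - ((1 - \<alpha>) * n))"
      unfolding powr_add qk by (simp only: mult_ac)
    also have "\<dots> \<le> 2 ^ n * C ^ (2 * n) * R"
      using L C C_powers by (intro mult_mono q_powr_le) (auto simp: algebra_simps)
    finally show ?thesis .
  qed
  have t2: "(\<Sum>v\<in>B1. ?pr v) \<le> 2 ^ n * C ^ (2 * n) * R"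
  proof -
    have "(\<Sum>v\<in>B1. ?pr v) \<le> 2 ^ n * C ^ n * real q powr (real (n - k) - 11 * \<alpha> * n)"
      unfolding B1_def using L k large by (intro small_support_sum_le) (auto simp: mult.assoc)
    also have "\<dots> \<le> 2 ^ n * C ^ (2 * n) * R"
      using L C C_powers k large by (intro mult_mono q_powr_le) (auto simp: mult.assoc)
    finally show ?thesis .
  qed
  have t3: "(\<Sum>v\<in>B2. ?pr v) \<le> 2 * (2 ^ n * C ^ (2 * n) * R)"
  proof -
    have "1 / \<epsilon>\<^sup>2 = real q powr (n / 2)"
      using q_pos unfolding \<epsilon>_def by (simp add: powr_minus power2_eq_square field_simps flip: powr_add)
    hence "real n * (real q ^ n * ((real q + 1) * \<beta>) / \<epsilon>\<^sup>2) * (C / q) ^ k =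
        real n * (real q ^ n * ((real q + 1) * \<beta>) * real q powr (n / 2)) * (C / q) ^ k"
      by (metis divide_inverse inverse_eq_divide)
    also have "\<dots> \<le> 2 ^ n * (real q powr n * ((2 * real q powr 1) * (C ^ n * real q powr (- ((1 - \<alpha>) * n))))
        * real q powr (n / 2)) * (C ^ n * real q powr (- (real n - real L)))"
    proof (intro mult_mono)
      have "(C / q) ^ k = C ^ k / real q ^ k" by (simp add: power_divide)
      also have "\<dots> = C ^ k * real q powr (- (real n - real L))"
        unfolding qk by (simp only: powr_minus divide_inverse)
      also have "\<dots> \<le> C ^ n * real q powr (- (real n - real L))"
        using k C by (intro mult_right_mono power_increasing) auto
      finally show "(C / q) ^ k \<le> C ^ n * real q powr (- (real n - real L))" .
      show "real q ^ n \<le> real q powr n" using q_pos by (simp add: powr_realpow)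
    qed (use n_le \<beta>_le q_ge1 C C_over_q in \<open>auto simp: \<beta>_def\<close>)
    also have "\<dots> = 2 * 2 ^ n * (C ^ n * C ^ n) * (real q powr n * real q powr 1 *
        real q powr (- ((1 - \<alpha>) * n)) * real q powr (n / 2) * real q powr (- (real n - real L)))"
      by (simp only: mult_ac)
    also have "C ^ n * C ^ n = C ^ (2 * n)" by (simp add: mult_2 power_add)
    also have "real q powr n * real q powr 1 *
        real q powr (- ((1 - \<alpha>) * n)) * real q powr (n / 2) * real q powr (- (real n - real L)) =
        real q powr (real n + 1 + - ((1 - \<alpha>) * n) + n / 2 + - (real n - real L))"
      unfolding powr_add ..
    also have "2 * 2 ^ n * C ^ (2 * n) * \<dots> \<le> 2 * 2 ^ n * C ^ (2 * n) * R"
      using L an large C by (intro mult_left_mono q_powr_le) (auto simp: algebra_simps)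
    finally show ?thesis
      using biased_sum_le [OF k(1) \<epsilon>0] unfolding B2_def \<beta>_def by (simp add: mult.assoc)
  qed
  have t4: "real (n - k) * (2 * \<epsilon>) \<le> 2 * (2 ^ n * C ^ (2 * n) * R)"
  proof -
    have \<epsilon>R: "\<epsilon> \<le> R" unfolding \<epsilon>_def using an by (intro q_powr_le) simp
    have "real (n - k) * 1 \<le> 2 ^ n * C ^ (2 * n)"
    proof (rule mult_mono [OF _ C_powers(3)])
      have "real (n - k) \<le> real n" by simp
      thus "real (n - k) \<le> 2 ^ n" using n_le by (rule order_trans)
    qed simp_all
    hence "real (n - k) * 1 * \<epsilon> \<le> 2 ^ n * C ^ (2 * n) * R"
      using \<epsilon>R by (rule mult_mono) (use \<epsilon>0 C in simp_all)
    thus ?thesis by simp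
  qed
  have t5: "\<bar>measure_pmf.prob (corank_chain (1 / q) (n - k) (n - k)) A - measure (Q_infinity q) A\<bar>
      \<le> 2 ^ n * C ^ (2 * n) * R"
  proof -
    have "2 * (1 / real q) ^ Suc L = (2 / q) * (1 / q) ^ L" by simp
    also have "\<dots> \<le> 1 * (1 / q) ^ L" using q_ge2 by (intro mult_right_mono) auto
    also have "\<dots> = real q powr (- real L)" using q_pos by (simp add: powr_minus powr_realpow power_divide field_simps)
    also have "\<dots> \<le> R" using L large by (intro q_powr_le) linarith
    also have "\<dots> \<le> 2 ^ n * C ^ (2 * n) * R"
      using R0 C_powers(3) mult_mono [of 1 "2 ^ n" 1 "C ^ (2 * n)"] by simp
    finally show ?thesis using corank_chain_vs_Q_infinity [OF q_ge_2, of L A] k by simp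
  qed
  have "(\<Sum>v\<in>B1 \<union> B2. ?pr v) \<le> (\<Sum>v\<in>B1. ?pr v) + (\<Sum>v\<in>B2. ?pr v)"
    using finB by (subst sum.union_inter [symmetric]) (auto intro!: sum_nonneg prod_nonneg)
  \<comment> \<open>The five bounds have the coefficients \<open>1, 1, 2, 2, 1\<close>.\<close>
  hence "\<bar>corank_prob A - measure (Q_infinity q) A\<bar> \<le> 7 * (2 ^ n * C ^ (2 * n) * R)"
    using main t1 t2 t3 t4 t5 by linarith
  also have "\<dots> \<le> 8 ^ n * (2 ^ n * C ^ (2 * n) * R)"
    using n C R0 power_increasing [of 1 n "8 :: real"] by (intro mult_right_mono) auto
  also have "\<dots> = (16 * C\<^sup>2) ^ n * R"
    unfolding collect_powers [symmetric] by (simp only: mult.assoc)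
  finally show ?thesis by (simp add: R_def)
qed

lemma corank_tv_dist_le:
  "tv_dist (map_pmf (corank K n) (Pi_pmf I undefined \<mu>)) (Q_infinity q) \<le>
    (16 * C\<^sup>2) ^ n * real q powr (- (\<alpha> * n))"
  using corank_prob_close_small corank_prob_close_large
  by (intro tv_dist_Q_infinity_leI) (meson not_less)

end

section \<open>The theorem\<close>

theorem theorem1p4:
  shows "\<exists>\<alpha>\<^sub>0 > (0::real). \<forall>\<alpha> C :: real. 0 < \<alpha> \<and> \<alpha> \<le> \<alpha>\<^sub>0 \<and> 1 \<le> C \<longrightarrow>
    (\<exists>C' c :: real. 0 < C' \<and> 0 < c \<and>
      (\<forall>(K :: nat ring) (n :: nat) (F :: nat \<Rightarrow> nat set) (\<mu> :: nat \<Rightarrow> (nat \<Rightarrow> nat) pmf).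
        field K \<and> finite (carrier K) \<and> 1 \<le> n \<and>
        (\<forall>i \<in> {1..n}. F i \<subseteq> {1..n} \<and> real (card (F i)) < \<alpha> * real n) \<and>
        (\<forall>i \<in> {1..n}. real (card {j \<in> {1..n}. i \<in> F j}) \<le> (1 - 12 * \<alpha>) * real n) \<and>
        (\<forall>i \<in> {1..n}. near_uniform_vector K C n (F i) (\<mu> i)) \<longrightarrow>
        tv_dist (map_pmf (corank K n) (Pi_pmf {1..n} undefined \<mu>)) (Q_infinity (card (carrier K)))
          \<le> (C' / real (card (carrier K))) powr (c * real n)))"
proof (rule exI [of _ "1 / 20 :: real"], intro conjI allI impI)
  fix \<alpha> C :: real
  assume \<alpha>C: "0 < \<alpha> \<and> \<alpha> \<le> 1 / 20 \<and> 1 \<le> C"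
  \<comment> \<open>The bound \<open>D\<^sup>n q\<^bsup>-\<alpha>n\<^esup>\<close> is \<open>(D\<^bsup>1/\<alpha>\<^esup> / q)\<^bsup>\<alpha>n\<^esup>\<close>.\<close>
  define D where "D = 16 * C\<^sup>2"
  have C1: "1 \<le> C" using \<alpha>C by simp
  have "C * 1 \<le> C * C" "1 * 1 \<le> C * C" using C1 by (intro mult_mono; simp)+
  hence D: "D \<ge> 1" "D \<ge> C" unfolding D_def power2_eq_square using C1 by linarith+
  have D_le: "D \<le> D powr (1 / \<alpha>)"
    using powr_mono [of 1 "1 / \<alpha>" D] D \<alpha>C by simp
  show "\<exists>C' c :: real. 0 < C' \<and> 0 < c \<and>
      (\<forall>(K :: nat ring) (n :: nat) (F :: nat \<Rightarrow> nat set) (\<mu> :: nat \<Rightarrow> (nat \<Rightarrow> nat) pmf).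
        field K \<and> finite (carrier K) \<and> 1 \<le> n \<and>
        (\<forall>i \<in> {1..n}. F i \<subseteq> {1..n} \<and> real (card (F i)) < \<alpha> * real n) \<and>
        (\<forall>i \<in> {1..n}. real (card {j \<in> {1..n}. i \<in> F j}) \<le> (1 - 12 * \<alpha>) * real n) \<and>
        (\<forall>i \<in> {1..n}. near_uniform_vector K C n (F i) (\<mu> i)) \<longrightarrow>
        tv_dist (map_pmf (corank K n) (Pi_pmf {1..n} undefined \<mu>)) (Q_infinity (card (carrier K)))
          \<le> (C' / real (card (carrier K))) powr (c * real n))"
  proof (rule exI [of _ "D powr (1 / \<alpha>)"], rule exI [of _ \<alpha>], intro conjI allI impI)
    show "0 < D powr (1 / \<alpha>)" "0 < \<alpha>" using D \<alpha>C by simp_all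
    fix K :: "nat ring" and n F \<mu>
    assume hyp: "field K \<and> finite (carrier K) \<and> 1 \<le> n \<and>
        (\<forall>i \<in> {1..n}. F i \<subseteq> {1..n} \<and> real (card (F i)) < \<alpha> * real n) \<and>
        (\<forall>i \<in> {1..n}. real (card {j \<in> {1..n}. i \<in> F j}) \<le> (1 - 12 * \<alpha>) * real n) \<and>
        (\<forall>i \<in> {1..n}. near_uniform_vector K C n (F i) (\<mu> i))"
    interpret finite_field K
      using hyp by (intro finite_field.intro finite_field_axioms.intro) blast+
    have q0: "real q > 0" using q_ge_2 by simp
    let ?tv = "tv_dist (map_pmf (corank K n) (Pi_pmf {1..n} undefined \<mu>)) (Q_infinity q)"
    show "?tv \<le> (D powr (1 / \<alpha>) / real q) powr (\<alpha> * real n)"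
    proof (cases "D powr (1 / \<alpha>) \<le> real q")
      case False
      hence "1 \<le> D powr (1 / \<alpha>) / real q" using q0 by simp
      hence "1 \<le> (D powr (1 / \<alpha>) / real q) powr (\<alpha> * real n)"
        using \<alpha>C by (intro ge_one_powr_ge_zero) auto
      thus ?thesis using tv_dist_Q_infinity_le_1 [OF q_ge_2] order_trans by blast
    next
      case True
      hence Cq: "C \<le> real q" using D D_le by linarith
      interpret near_uniform_columns K n F \<mu> \<alpha> C
        by unfold_locales (use hyp \<alpha>C Cq in blast)+
      have "(D powr (1 / \<alpha>) / real q) powr (\<alpha> * real n) =
          (D powr (1 / \<alpha>)) powr (\<alpha> * real n) * real q powr (- (\<alpha> * real n))"
        using q0 D by (simp add: powr_divide powr_minus_divide)
      also have "(D powr (1 / \<alpha>)) powr (\<alpha> * real n) = D ^ n"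
        using D \<alpha>C by (simp add: powr_powr powr_realpow)
      finally show ?thesis using corank_tv_dist_le by (simp add: D_def)
    qed
  qed
qed simp
end
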